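(* Let $\sigma>0$, let $x_1,\dots,x_N\in\mathbb{R}^n$ be $s$-sparse, let $1\le k<N$ and $0<\epsilon<1$. Let $\Phi$ be an $m\times n$ random matrix with independent $\mathcal{N}(0,1)$ entries. Let $A$ be the affinity matrix of $x_1,\dots,x_N$ and $\tilde A$ the affinity matrix of the compressed measurements $\frac1{\sqrt m}\Phi x_1,\dots,\frac1{\sqrt m}\Phi x_N$. Suppose there is an $\alpha>0$ such that $\lambda_k-\lambda_{k+1}\ge\alpha$ and $\lambda_k\ge\alpha$. If the number of measurements is $$m=O\left(\frac{s}{\epsilon^2}\log\frac{n}{\epsilon^2 s}\right),$$ then with high probability, for every $i\in\{1,\dots,N\}$, $$\|\tilde v(i)-v(i)Q\|_2\le(1+\sqrt2)\,\frac{N\epsilon}{\alpha}.$$ Here the condition on $m$ and "with high probability" mean: for every $\eta\in(0,1)$ there is a constant $c>0$, depending only on $\eta$ and on $\max_{i,j}\frac{\|x_i-x_j\|_2^2}{2\sigma}$, such that if $m\ge c\,\frac{s}{\epsilon^2}\log\frac{n}{\epsilon^2 s}$ then the bound holds with probability at least $1-\eta$.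
   Context: A vector is $s$-sparse if it has at most $s$ nonzero entries. For points $z_1,\dots,z_N$ in a Euclidean space, the affinity matrix is $D^{-1/2}WD^{-1/2}$, where $W_{i,j}=e^{-\frac{\|z_i-z_j\|_2^2}{2\sigma}}$ and $D$ is the diagonal matrix with $D_{i,i}=\sum_{l=1}^N W_{i,l}$. Let $\lambda_1\ge\dots\ge\lambda_N$ be the eigenvalues of $A$ with orthonormal eigenvectors $v_1,\dots,v_N$, and let $\tilde v_1,\dots,\tilde v_N$ be orthonormal eigenvectors of $\tilde A$ ordered by decreasing eigenvalue. Put $V_k=[v_1,\dots,v_k]$ and $\tilde V_k=[\tilde v_1,\dots,\tilde v_k]$ in $\mathbb{R}^{N\times k}$; $v(i)$ and $\tilde v(i)$ denote the $i$-th rows of $V_k$ and $\tilde V_k$. $Q$ is the $k\times k$ orthogonal matrix that minimizes $\|\tilde V_k-V_kQ\|_F$ over $k\times k$ orthogonal matrices. *)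

theory Defs
  imports "HOL-Probability.Probability" "Jordan_Normal_Form.Char_Poly"
begin

text \<open>
  Vectors and matrices are those of \<^theory>\<open>Jordan_Normal_Form.Matrix\<close>, since the constant in the
  statement has to be uniform in all dimensions and these must therefore be quantifiable.
  All indices start at 0: the \<open>k\<close>-th largest eigenvalue is \<open>lam (k - 1)\<close>.
\<close>

definition vnorm :: "real vec \<Rightarrow> real" where
  "vnorm u = sqrt (scalar_prod u u)"

definition frob_norm :: "real mat \<Rightarrow> real" where
  "frob_norm A = sqrt (\<Sum>i<dim_row A. \<Sum>j<dim_col A. (A $$ (i, j))\<^sup>2)"

definition sparse_vec :: "nat \<Rightarrow> real vec \<Rightarrow> bool" where
  "sparse_vec s u \<longleftrightarrow> card {j. j < dim_vec u \<and> vec_index u j \<noteq> 0} \<le> s"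

definition scaled_sqdist :: "real \<Rightarrow> real vec \<Rightarrow> real vec \<Rightarrow> real" where
  "scaled_sqdist \<sigma> u w = (vnorm (u - w))\<^sup>2 / (2 * \<sigma>)"

definition max_scaled_sqdist :: "real \<Rightarrow> nat \<Rightarrow> (nat \<Rightarrow> real vec) \<Rightarrow> real" where
  "max_scaled_sqdist \<sigma> N x = Max ((\<lambda>(i, j). scaled_sqdist \<sigma> (x i) (x j)) ` ({..<N} \<times> {..<N}))"

definition weight_mat :: "real \<Rightarrow> nat \<Rightarrow> (nat \<Rightarrow> real vec) \<Rightarrow> real mat" where
  "weight_mat \<sigma> N z = mat N N (\<lambda>(i, j). exp (- scaled_sqdist \<sigma> (z i) (z j)))"

definition vertex_degree :: "real \<Rightarrow> nat \<Rightarrow> (nat \<Rightarrow> real vec) \<Rightarrow> nat \<Rightarrow> real" where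
  "vertex_degree \<sigma> N z i = (\<Sum>l<N. weight_mat \<sigma> N z $$ (i, l))"

text \<open>
  The degrees are positive, so the power \<open>-1/2\<close> of the diagonal matrix \<open>D\<close> is taken entrywise on
  the diagonal.
\<close>
definition affinity_mat :: "real \<Rightarrow> nat \<Rightarrow> (nat \<Rightarrow> real vec) \<Rightarrow> real mat" where
  "affinity_mat \<sigma> N z =
     (let D' = mat_diag N (\<lambda>i. vertex_degree \<sigma> N z i powr (- 1 / 2))
      in D' * weight_mat \<sigma> N z * D')"

definition ordered_orthonormal_eigenbasis ::
    "real mat \<Rightarrow> (nat \<Rightarrow> real) \<Rightarrow> (nat \<Rightarrow> real vec) \<Rightarrow> bool" where
  "ordered_orthonormal_eigenbasis A lam v \<longleftrightarrow>
     (\<forall>i<dim_row A. eigenvector A (v i) (lam i)) \<and>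
     (\<forall>i<dim_row A. \<forall>j<dim_row A. scalar_prod (v i) (v j) = (if i = j then 1 else 0)) \<and>
     (\<forall>i j. i \<le> j \<longrightarrow> j < dim_row A \<longrightarrow> lam j \<le> lam i)"

definition first_cols :: "nat \<Rightarrow> nat \<Rightarrow> (nat \<Rightarrow> real vec) \<Rightarrow> real mat" where
  "first_cols N k v = mat_of_cols N (map v [0..<k])"

text \<open>
  Orthogonal in the usual sense; the library's \<^const>\<open>orthogonal_mat\<close> does not require columns of
  norm 1.
\<close>
definition orthogonal_mats :: "nat \<Rightarrow> real mat set" where
  "orthogonal_mats k = {Q \<in> carrier_mat k k. transpose_mat Q * Q = 1\<^sub>m k}"

text \<open>
  An \<open>m \<times> n\<close> matrix with independent standard normal entries, realised on the product space whose
  coordinates are its entries.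
\<close>
definition gaussian_space :: "nat \<Rightarrow> nat \<Rightarrow> (nat \<times> nat \<Rightarrow> real) measure" where
  "gaussian_space m n = PiM ({..<m} \<times> {..<n}) (\<lambda>_. std_normal_distribution)"

definition gaussian_mat :: "nat \<Rightarrow> nat \<Rightarrow> (nat \<times> nat \<Rightarrow> real) \<Rightarrow> real mat" where
  "gaussian_mat m n \<omega> = mat m n \<omega>"

definition compressed :: "nat \<Rightarrow> real mat \<Rightarrow> real vec \<Rightarrow> real vec" where
  "compressed m \<Phi> u = (1 / sqrt (real m)) \<cdot>\<^sub>v (\<Phi> *\<^sub>v u)"

end

theory Submission
  imports Defs
begin

text \<open>
  Write \<open>V\<close>, \<open>W\<close> for the matrices of the leading \<open>k\<close> eigenvectors of the affinity matrix \<open>A\<close> of the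
  points and of the affinity matrix \<open>A'\<close> of the compressed points.

  Perturbation. Put \<open>D = k - \<parallel>V\<^sup>T W\<parallel>\<^sup>2\<close> in the Frobenius norm; then
  \<open>\<parallel>V V\<^sup>T - W W\<^sup>T\<parallel>\<^sup>2 = 2 D\<close>. By Ky Fan's maximum principle, in a form that keeps track of the
  spectral gap (\<open>eigenspace_energy_gap\<close>), \<open>\<langle>A, V V\<^sup>T - W W\<^sup>T\<rangle>\<close> is at least \<open>\<alpha> D\<close>, while
  \<open>\<langle>A', V V\<^sup>T - W W\<^sup>T\<rangle>\<close> is at most 0. Subtracting, \<open>\<alpha> D \<le> \<parallel>A - A'\<parallel> \<surd>(2 D)\<close>, and nothing has to be
  known about the eigenvalues of \<open>A'\<close>. For the optimal \<open>Q\<close> the matrix \<open>Q\<^sup>T V\<^sup>T W\<close> is symmetric,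
  positive semidefinite and a contraction, so its trace is at least its squared Frobenius norm, and
  this says that \<open>\<parallel>W - V Q\<parallel>\<^sup>2 \<le> 2 D\<close> (\<open>procrustes_optimum_bound\<close>). Hence
  \<open>\<parallel>W - V Q\<parallel> \<le> 2 \<parallel>A - A'\<parallel> / \<alpha>\<close> (\<open>aligned_eigenvectors_perturbation\<close>), a bound for every row of
  \<open>W - V Q\<close>, with \<open>2 \<le> 1 + \<surd>2\<close>.

  Affinities. The entries of an affinity matrix lie between 0 and 1, and changing all scaled squared
  distances by at most \<open>\<tau>\<close> multiplies them by factors between \<open>exp (- 2 \<tau>)\<close> and \<open>exp (2 \<tau>)\<close>.
  So \<open>\<tau> = \<epsilon> / 4\<close> gives \<open>\<parallel>A - A'\<parallel> \<le> N \<epsilon>\<close> (\<open>affinity_mat_perturbation\<close>).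

  Probability. A Gaussian matrix distorts one given squared distance by a factor outside
  \<open>[1 - \<delta>, 1 + \<delta>]\<close> with probability at most \<open>2 exp (- m \<delta>\<^sup>2 / 16)\<close>, and a union bound treats the
  \<open>N\<^sup>2\<close> pairs of points; \<open>\<delta>\<close> of order \<open>\<epsilon> / (1 + B)\<close> suffices. The factor \<open>N\<^sup>2\<close> is harmless because
  the claim has content only for \<open>N < 1 / \<epsilon>\<close>: the rows of \<open>W\<close> and of \<open>V Q\<close> have norm at most 1 and
  \<open>\<alpha>\<close> is at most 1, the eigenvalues of \<open>A\<close> being at most 1. So
  \<open>N\<^sup>2 < exp (ln (1 / \<epsilon>\<^sup>2))\<close>, which \<open>m \<ge> c / \<epsilon>\<^sup>2 * ln (1 / \<epsilon>\<^sup>2)\<close> absorbs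
  (\<open>failure_probability_le\<close>).
\<close>

section \<open>The Frobenius inner product\<close>

definition frob_inner :: "real mat \<Rightarrow> real mat \<Rightarrow> real" where
  "frob_inner A B = (\<Sum>i<dim_row A. \<Sum>j<dim_col A. A $$ (i, j) * B $$ (i, j))"

lemma frob_norm_sq: "(frob_norm A)\<^sup>2 = frob_inner A A"
  unfolding frob_norm_def frob_inner_def
  by (subst real_sqrt_pow2) (auto intro!: sum_nonneg simp: power2_eq_square)

lemma frob_inner_commute:
  assumes "A \<in> carrier_mat r c" "B \<in> carrier_mat r c"
  shows "frob_inner A B = frob_inner B A"
  using assms unfolding frob_inner_def by (simp add: mult.commute)

lemma frob_inner_minus_right:
  assumes "A \<in> carrier_mat r c" "B \<in> carrier_mat r c" "C \<in> carrier_mat r c"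
  shows "frob_inner A (B - C) = frob_inner A B - frob_inner A C"
  using assms unfolding frob_inner_def by (simp add: right_diff_distrib sum_subtractf)

lemma frob_inner_minus_left:
  assumes "A \<in> carrier_mat r c" "B \<in> carrier_mat r c" "C \<in> carrier_mat r c"
  shows "frob_inner (B - C) A = frob_inner B A - frob_inner C A"
  using assms unfolding frob_inner_def by (simp add: left_diff_distrib sum_subtractf)

lemma frob_inner_transpose:
  assumes "A \<in> carrier_mat r c" "B \<in> carrier_mat r c"
  shows "frob_inner (transpose_mat A) (transpose_mat B) = frob_inner A B"
proof -
  have "frob_inner (transpose_mat A) (transpose_mat B) = (\<Sum>j<c. \<Sum>i<r. A $$ (i, j) * B $$ (i, j))"
    using assms unfolding frob_inner_def by simp
  also have "\<dots> = frob_inner A B"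
    using assms unfolding frob_inner_def by (subst sum.swap) simp
  finally show ?thesis .
qed

lemma index_mult_mat_sum:
  assumes "A \<in> carrier_mat r n" "B \<in> carrier_mat n c" "i < r" "j < c"
  shows "(A * B) $$ (i, j) = (\<Sum>l<n. A $$ (i, l) * B $$ (l, j))"
  using assms by (auto simp: scalar_prod_def atLeast0LessThan intro!: sum.cong)

text \<open>
  Left multiplication by \<open>B\<close> has the adjoint \<open>transpose_mat B\<close>. With its two variants below, this
  replaces every manipulation of traces.
\<close>
lemma frob_inner_mult_right:
  assumes "A \<in> carrier_mat r c" "B \<in> carrier_mat r n" "C \<in> carrier_mat n c"
  shows "frob_inner A (B * C) = frob_inner (transpose_mat B * A) C"
proof -
  have "frob_inner A (B * C) = (\<Sum>i<r. \<Sum>j<c. \<Sum>l<n. A $$ (i, j) * (B $$ (i, l) * C $$ (l, j)))"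
    using assms unfolding frob_inner_def
    by (auto simp: index_mult_mat_sum[of B r n C c] sum_distrib_left simp del: index_mult_mat(1)
        intro!: sum.cong)
  also have "\<dots> = (\<Sum>i<r. \<Sum>l<n. \<Sum>j<c. A $$ (i, j) * (B $$ (i, l) * C $$ (l, j)))"
    by (intro sum.cong refl sum.swap)
  also have "\<dots> = (\<Sum>l<n. \<Sum>i<r. \<Sum>j<c. A $$ (i, j) * (B $$ (i, l) * C $$ (l, j)))"
    by (rule sum.swap)
  also have "\<dots> = (\<Sum>l<n. \<Sum>j<c. \<Sum>i<r. A $$ (i, j) * (B $$ (i, l) * C $$ (l, j)))"
    by (intro sum.cong refl sum.swap)
  also have "\<dots> = (\<Sum>l<n. \<Sum>j<c. \<Sum>i<r. B $$ (i, l) * A $$ (i, j) * C $$ (l, j))"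
    by (simp add: mult_ac)
  also have "\<dots> = frob_inner (transpose_mat B * A) C"
    using assms unfolding frob_inner_def
    by (auto simp: index_mult_mat_sum[of "transpose_mat B" n r A c] sum_distrib_right
        simp del: index_mult_mat(1) intro!: sum.cong)
  finally show ?thesis .
qed

lemma frob_inner_mult_left:
  assumes "A \<in> carrier_mat r n" "B \<in> carrier_mat n c" "C \<in> carrier_mat r c"
  shows "frob_inner (A * B) C = frob_inner B (transpose_mat A * C)"
proof -
  have AB: "A * B \<in> carrier_mat r c" and AC: "transpose_mat A * C \<in> carrier_mat n c"
    using assms by auto
  show ?thesis
    unfolding frob_inner_commute[OF AB assms(3)] frob_inner_commute[OF assms(2) AC]
    by (rule frob_inner_mult_right[OF assms(3,1,2)])
qed

lemma frob_inner_mult_right':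
  assumes "A \<in> carrier_mat r c" "B \<in> carrier_mat r n" "C \<in> carrier_mat n c"
  shows "frob_inner A (B * C) = frob_inner (A * transpose_mat C) B"
proof -
  have "frob_inner A (B * C) = frob_inner (transpose_mat A) (transpose_mat C * transpose_mat B)"
    using assms by (simp add: frob_inner_transpose[of A r c] flip: transpose_mult[of B r n C c])
  also have "\<dots> = frob_inner (C * transpose_mat A) (transpose_mat B)"
    using assms by (subst frob_inner_mult_right[of _ c r _ n]) auto
  also have "C * transpose_mat A = transpose_mat (A * transpose_mat C)"
    using assms by (subst transpose_mult[of A r c _ n]) auto
  finally show ?thesis
    using assms by (simp add: frob_inner_transpose[of _ r n])
qed

lemma frob_inner_one_right:
  assumes "A \<in> carrier_mat k k"
  shows "frob_inner A (1\<^sub>m k) = (\<Sum>i<k. A $$ (i, i))"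
proof -
  have "(\<Sum>j<k. A $$ (i, j) * 1\<^sub>m k $$ (i, j)) = A $$ (i, i)" if "i < k" for i
    using that by (subst sum.remove[of _ i]) (auto intro!: sum.neutral)
  then show ?thesis
    using assms unfolding frob_inner_def by simp
qed

lemma frob_inner_Cauchy_Schwarz:
  assumes "A \<in> carrier_mat r c" "B \<in> carrier_mat r c"
  shows "frob_inner A B \<le> frob_norm A * frob_norm B"
proof -
  have "frob_inner A B = (\<Sum>p\<in>{..<r} \<times> {..<c}. A $$ p * B $$ p)"
    using assms unfolding frob_inner_def by (simp add: sum.cartesian_product)
  also have "\<dots> \<le> (\<Sum>p\<in>{..<r} \<times> {..<c}. \<bar>A $$ p\<bar> * \<bar>B $$ p\<bar>)"
    by (intro sum_mono) (simp flip: abs_mult)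
  also have "\<dots> \<le> L2_set (($$) A) ({..<r} \<times> {..<c}) * L2_set (($$) B) ({..<r} \<times> {..<c})"
    by (rule L2_set_mult_ineq)
  also have "\<dots> = frob_norm A * frob_norm B"
    using assms unfolding frob_norm_def L2_set_def by (simp add: sum.cartesian_product)
  finally show ?thesis .
qed

lemma frob_norm_nonneg: "0 \<le> frob_norm A"
  unfolding frob_norm_def by (simp add: sum_nonneg)

lemma scalar_prod_self_eq: "scalar_prod u u = (\<Sum>i<dim_vec u. (vec_index u i)\<^sup>2)" for u :: "real vec"
  by (simp add: scalar_prod_def power2_eq_square atLeast0LessThan)

lemma scalar_prod_self_nonneg: "0 \<le> scalar_prod u u" for u :: "real vec"
  by (simp add: scalar_prod_self_eq sum_nonneg)

lemma vnorm_sq: "(vnorm u)\<^sup>2 = scalar_prod u u"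
  by (simp add: vnorm_def scalar_prod_self_nonneg)

lemma vnorm_row_le_frob_norm:
  assumes "i < dim_row A"
  shows "vnorm (row A i) \<le> frob_norm A"
proof -
  have "scalar_prod (row A i) (row A i) = (\<Sum>j<dim_col A. (A $$ (i, j))\<^sup>2)"
    using assms by (auto simp: scalar_prod_self_eq intro!: sum.cong)
  also have "\<dots> \<le> (\<Sum>i<dim_row A. \<Sum>j<dim_col A. (A $$ (i, j))\<^sup>2)"
    using assms by (intro member_le_sum[of i _ "\<lambda>i. \<Sum>j<dim_col A. (A $$ (i, j))\<^sup>2"] sum_nonneg) auto
  finally show ?thesis
    unfolding vnorm_def frob_norm_def by simp
qed

section \<open>Householder reflections\<close>

text \<open>
  Reflection in the hyperplane orthogonal to \<open>u\<close>. The vector need not be normalised, so that lines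
  \<open>u + t \<cdot> z\<close> of reflection vectors can be used.
\<close>
definition householder :: "real vec \<Rightarrow> real mat" where
  "householder u = mat (dim_vec u) (dim_vec u)
     (\<lambda>(i, j). (if i = j then 1 else 0)
        - 2 / scalar_prod u u * (vec_index u i * vec_index u j))"

lemma householder_carrier [simp]:
  "u \<in> carrier_vec k \<Longrightarrow> householder u \<in> carrier_mat k k"
  by (auto simp: householder_def)

lemma transpose_householder: "transpose_mat (householder u) = householder u"
  by (rule eq_matI) (auto simp: householder_def)

lemma householder_mult_vec:
  assumes "u \<in> carrier_vec k" "x \<in> carrier_vec k"
  shows "householder u *\<^sub>v x = x - (2 / scalar_prod u u * scalar_prod u x) \<cdot>\<^sub>v u"
proof (rule eq_vecI)
  fix i assume "i < dim_vec (x - (2 / scalar_prod u u * scalar_prod u x) \<cdot>\<^sub>v u)"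
  then have i: "i < k"
    using assms by simp
  have "vec_index (householder u *\<^sub>v x) i
      = (\<Sum>j<k. ((if i = j then 1 else 0) - 2 / scalar_prod u u * (vec_index u i * vec_index u j)) * vec_index x j)"
    using assms i by (auto simp: householder_def scalar_prod_def atLeast0LessThan intro!: sum.cong)
  also have "\<dots> = (\<Sum>j<k. (if i = j then vec_index x j else 0)
      - 2 / scalar_prod u u * vec_index u i * (vec_index u j * vec_index x j))"
    by (intro sum.cong) (auto simp: algebra_simps)
  also have "\<dots> = vec_index x i - 2 / scalar_prod u u * vec_index u i * scalar_prod u x"
    unfolding sum_subtractf sum_distrib_left[symmetric]
    using assms i by (simp add: scalar_prod_def[of u x] atLeast0LessThan)
  finally show "vec_index (householder u *\<^sub>v x) i
      = vec_index (x - (2 / scalar_prod u u * scalar_prod u x) \<cdot>\<^sub>v u) i"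
    using assms i by (simp add: mult_ac)
qed (use assms in \<open>auto simp: householder_def\<close>)

text \<open>
  Reflections therefore probe the quadratic form of \<open>S\<close>: this drives the optimality argument for
  the Procrustes problem.
\<close>
lemma frob_inner_householder:
  assumes "S \<in> carrier_mat k k" "u \<in> carrier_vec k"
  shows "frob_inner S (householder u)
    = frob_inner S (1\<^sub>m k) - 2 / scalar_prod u u * scalar_prod u (S *\<^sub>v u)"
proof -
  have "frob_inner S (householder u) = (\<Sum>i<k. \<Sum>j<k. S $$ (i, j) * 1\<^sub>m k $$ (i, j)
      - 2 / scalar_prod u u * (vec_index u i * (S $$ (i, j) * vec_index u j)))"
    using assms unfolding frob_inner_def by (auto simp: householder_def algebra_simps intro!: sum.cong)
  also have "\<dots> = frob_inner S (1\<^sub>m k) - 2 / scalar_prod u u *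
      (\<Sum>i<k. vec_index u i * (\<Sum>j<k. S $$ (i, j) * vec_index u j))"
    using assms unfolding frob_inner_def by (simp add: sum_subtractf sum_distrib_left)
  also have "(\<Sum>i<k. vec_index u i * (\<Sum>j<k. S $$ (i, j) * vec_index u j)) = scalar_prod u (S *\<^sub>v u)"
    using assms by (auto simp: scalar_prod_def atLeast0LessThan intro!: sum.cong)
  finally show ?thesis .
qed

lemma householder_orthogonal:
  assumes u: "u \<in> carrier_vec k" and pos: "0 < scalar_prod u u"
  shows "householder u \<in> orthogonal_mats k"
proof -
  let ?H = "householder u"
  have refl: "scalar_prod u (?H *\<^sub>v x) = - scalar_prod u x" if "x \<in> carrier_vec k" for x
    using u pos that by (simp add: householder_mult_vec[OF u that] scalar_prod_minus_distrib[of _ k])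
  have "?H *\<^sub>v (?H *\<^sub>v x) = x" if x: "x \<in> carrier_vec k" for x
  proof -
    have "?H *\<^sub>v x \<in> carrier_vec k"
      using u x by (simp add: mult_mat_vec_carrier[of _ k k])
    then show ?thesis
      unfolding householder_mult_vec[OF u \<open>?H *\<^sub>v x \<in> _\<close>] refl[OF x]
      unfolding householder_mult_vec[OF u x] using u x by (intro eq_vecI) auto
  qed
  then have inv: "?H *\<^sub>v (?H *\<^sub>v unit_vec k j) = unit_vec k j" for j
    by simp
  have col_eq: "?H *\<^sub>v unit_vec k j = col ?H j" if "j < k" for j
    using householder_carrier[OF u] that by (intro eq_vecI) auto
  have "?H * ?H = 1\<^sub>m k"
  proof (rule mat_col_eqI)
    fix j assume "j < dim_col (1\<^sub>m k :: real mat)"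
    then show "col (?H * ?H) j = col (1\<^sub>m k) j"
      using inv[of j] by (simp add: col_eq col_mult2[OF householder_carrier[OF u] householder_carrier[OF u]])
  qed (use householder_carrier[OF u] in auto)
  then show ?thesis
    using u by (simp add: orthogonal_mats_def transpose_householder)
qed

lemma orthogonal_mats_mult:
  assumes "P \<in> orthogonal_mats k" "Q \<in> orthogonal_mats k"
  shows "P * Q \<in> orthogonal_mats k"
proof -
  have c: "P \<in> carrier_mat k k" "Q \<in> carrier_mat k k"
    and o: "transpose_mat P * P = 1\<^sub>m k" "transpose_mat Q * Q = 1\<^sub>m k"
    using assms by (auto simp: orthogonal_mats_def)
  have "transpose_mat (P * Q) * (P * Q) = transpose_mat Q * (transpose_mat P * P) * Q"
    using c by (simp add: transpose_mult[of P k k Q k] assoc_mult_mat[of _ k k _ k _ k])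
  also have "\<dots> = 1\<^sub>m k"
    using c o by simp
  finally show ?thesis
    using c by (simp add: orthogonal_mats_def)
qed

lemma orthogonal_mats_mult_transpose:
  assumes "Q \<in> orthogonal_mats k"
  shows "Q * transpose_mat Q = 1\<^sub>m k"
  using assms mat_mult_left_right_inverse[of "transpose_mat Q" k Q] by (simp add: orthogonal_mats_def)

section \<open>The orthogonal Procrustes problem\<close>

text \<open>
  Testing the optimality of the identity against single reflections sees only the symmetric part of
  \<open>S\<close>. A product of two reflections, which is a rotation, also sees the antisymmetric part, since
  \<open>scalar_prod u (S *\<^sub>v w)\<close> occurs here without its mirror image.
\<close>
lemma two_householder_inequality:
  assumes S: "S \<in> carrier_mat k k"
    and opt: "\<And>G. G \<in> orthogonal_mats k \<Longrightarrow> frob_inner S G \<le> frob_inner S (1\<^sub>m k)"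
    and u: "u \<in> carrier_vec k" "0 < scalar_prod u u"
    and w: "w \<in> carrier_vec k" "0 < scalar_prod w w"
  shows "2 * scalar_prod w u * scalar_prod u (S *\<^sub>v w)
    \<le> scalar_prod w w * scalar_prod u (S *\<^sub>v u) + scalar_prod u u * scalar_prod w (S *\<^sub>v w)"
proof -
  let ?H = householder
  have c: "?H u \<in> carrier_mat k k" "?H w \<in> carrier_mat k k" "?H u * S \<in> carrier_mat k k"
    "S *\<^sub>v w \<in> carrier_vec k"
    using u w S by (auto intro!: mult_mat_vec_carrier[of _ k k] mult_carrier_mat[of _ k k])
  have "frob_inner S (?H u * ?H w) = frob_inner (?H u * S) (?H w)"
    using frob_inner_mult_right[OF S c(1,2)] by (simp add: transpose_householder)
  also have "\<dots> = frob_inner (?H u * S) (1\<^sub>m k) - 2 / scalar_prod w w * scalar_prod w ((?H u * S) *\<^sub>v w)"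
    by (rule frob_inner_householder[OF c(3) w(1)])
  also have "frob_inner (?H u * S) (1\<^sub>m k) = frob_inner S (?H u)"
    using c S by (subst frob_inner_mult_left[of _ k k]) (auto simp: transpose_householder)
  also have "frob_inner S (?H u) = frob_inner S (1\<^sub>m k) - 2 / scalar_prod u u * scalar_prod u (S *\<^sub>v u)"
    by (rule frob_inner_householder[OF S u(1)])
  also have "(?H u * S) *\<^sub>v w = S *\<^sub>v w - (2 / scalar_prod u u * scalar_prod u (S *\<^sub>v w)) \<cdot>\<^sub>v u"
    using assoc_mult_mat_vec[OF c(1) S w(1)] householder_mult_vec[OF u(1) c(4)] by simp
  also have "scalar_prod w \<dots> = scalar_prod w (S *\<^sub>v w)
      - 2 / scalar_prod u u * scalar_prod u (S *\<^sub>v w) * scalar_prod w u"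
    using u w c by (subst scalar_prod_minus_distrib[of _ k]) auto
  finally have "frob_inner S (?H u * ?H w) = frob_inner S (1\<^sub>m k)
      - 2 / scalar_prod u u * scalar_prod u (S *\<^sub>v u)
      - 2 / scalar_prod w w * (scalar_prod w (S *\<^sub>v w)
          - 2 / scalar_prod u u * scalar_prod u (S *\<^sub>v w) * scalar_prod w u)" .
  moreover have "frob_inner S (?H u * ?H w) \<le> frob_inner S (1\<^sub>m k)"
    by (intro opt orthogonal_mats_mult householder_orthogonal u w)
  ultimately have "0 \<le> 2 / scalar_prod u u * scalar_prod u (S *\<^sub>v u)
      + 2 / scalar_prod w w * (scalar_prod w (S *\<^sub>v w)
          - 2 / scalar_prod u u * scalar_prod u (S *\<^sub>v w) * scalar_prod w u)" (is "0 \<le> ?e")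
    by linarith
  then have "0 \<le> scalar_prod u u * scalar_prod w w / 2 * ?e"
    using u w by (intro mult_nonneg_nonneg) auto
  also have "\<dots> = scalar_prod w w * scalar_prod u (S *\<^sub>v u) + scalar_prod u u * scalar_prod w (S *\<^sub>v w)
      - 2 * scalar_prod w u * scalar_prod u (S *\<^sub>v w)"
    using u w by (simp add: field_simps)
  finally show ?thesis
    by linarith
qed

text \<open>First-order condition: \<open>a t\<^sup>2 - b t\<close> can have its minimum at 0 only if its slope there vanishes.\<close>
lemma linear_term_zero:
  fixes a b :: real
  assumes "\<And>t. t * b \<le> t\<^sup>2 * a"
  shows "b = 0"
proof -
  \<comment> \<open>The inequality is violated at \<open>t = b / c\<close>, for any positive \<open>c > a\<close>, unless \<open>b = 0\<close>.\<close>
  define c where "c = \<bar>a\<bar> + 1"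
  have c: "0 < c" "a < c"
    by (auto simp: c_def)
  have "b\<^sup>2 * c = c\<^sup>2 * (b / c * b)"
    using c by (simp add: power2_eq_square)
  also have "\<dots> \<le> c\<^sup>2 * ((b / c)\<^sup>2 * a)"
    using assms[of "b / c"] by (intro mult_left_mono) auto
  also have "\<dots> = b\<^sup>2 * a"
    using c by (simp add: power2_eq_square)
  finally have "b\<^sup>2 * (c - a) \<le> 0"
    by (simp add: algebra_simps)
  with c show "b = 0"
    by (simp add: mult_le_0_iff)
qed

text \<open>
  The condition of first order at \<open>t = 0\<close> for the rotations obtained by reflecting in \<open>e\<^sub>i\<close> and in
  \<open>e\<^sub>i + t e\<^sub>j\<close>.
\<close>
lemma identity_alignment_optimal_imp_symmetric:
  assumes S: "S \<in> carrier_mat k k"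
    and opt: "\<And>G. G \<in> orthogonal_mats k \<Longrightarrow> frob_inner S G \<le> frob_inner S (1\<^sub>m k)"
  shows "transpose_mat S = S"
proof (rule eq_matI)
  fix i j assume "i < dim_row S" "j < dim_col S"
  then have ij: "i < k" "j < k"
    using S by auto
  have "S $$ (i, j) - S $$ (j, i) = 0" if "i \<noteq> j"
  proof (rule linear_term_zero)
    fix t :: real
    define u w where "u = (unit_vec k i :: real vec)" and "w = unit_vec k i + t \<cdot>\<^sub>v (unit_vec k j :: real vec)"
    have c: "u \<in> carrier_vec k" "w \<in> carrier_vec k"
      by (auto simp: u_def w_def)
    have col_eq: "S *\<^sub>v unit_vec k l = col S l" if "l < k" for l
      using S that by (intro eq_vecI) auto
    have Su: "S *\<^sub>v u = col S i" and Sw: "S *\<^sub>v w = col S i + t \<cdot>\<^sub>v col S j"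
      using ij S by (auto simp: u_def w_def col_eq mult_add_distrib_mat_vec[of S k k] mult_mat_vec[of S k k])
    have uu: "scalar_prod u u = 1" and wu: "scalar_prod w u = 1" and ww: "scalar_prod w w = 1 + t\<^sup>2"
      using ij that by (auto simp: u_def w_def add_scalar_prod_distrib[of _ k] power2_eq_square)
    have uSu: "scalar_prod u (S *\<^sub>v u) = S $$ (i, i)"
      and uSw: "scalar_prod u (S *\<^sub>v w) = S $$ (i, i) + t * S $$ (i, j)"
      and wSw: "scalar_prod w (S *\<^sub>v w)
        = S $$ (i, i) + t * S $$ (i, j) + t * (S $$ (j, i) + t * S $$ (j, j))"
      unfolding Su Sw using ij S by (auto simp: u_def w_def add_scalar_prod_distrib[of _ k])
    have "0 < 1 + t\<^sup>2"
      by (simp add: add_pos_nonneg)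
    then show "t * (S $$ (i, j) - S $$ (j, i)) \<le> t\<^sup>2 * (S $$ (i, i) + S $$ (j, j))"
      using two_householder_inequality[OF S opt c(1) _ c(2)] unfolding uu wu ww uSu uSw wSw
      by (simp add: algebra_simps power2_eq_square)
  qed
  then show "transpose_mat S $$ (i, j) = S $$ (i, j)"
    using S ij by (cases "i = j") auto
qed (use S in auto)

text \<open>A negative direction of \<open>S\<close> could be reflected to increase the trace.\<close>
lemma identity_alignment_optimal_imp_psd:
  assumes S: "S \<in> carrier_mat k k"
    and opt: "\<And>G. G \<in> orthogonal_mats k \<Longrightarrow> frob_inner S G \<le> frob_inner S (1\<^sub>m k)"
    and x: "x \<in> carrier_vec k"
  shows "0 \<le> scalar_prod x (S *\<^sub>v x)"
proof (cases "scalar_prod x x = 0")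
  case True
  then have "vec_index x i = 0" if "i < k" for i
    using x that by (simp add: scalar_prod_self_eq sum_nonneg_eq_0_iff)
  then have "x = 0\<^sub>v k"
    using x by (intro eq_vecI) auto
  then show ?thesis
    using S by (simp add: mult_mat_vec_carrier[of _ k k])
next
  case False
  then have pos: "0 < scalar_prod x x"
    using scalar_prod_self_nonneg[of x] by linarith
  have "2 / scalar_prod x x * scalar_prod x (S *\<^sub>v x) \<ge> 0"
    using opt[OF householder_orthogonal[OF x pos]] unfolding frob_inner_householder[OF S x] by linarith
  with pos show ?thesis
    by (simp add: zero_le_divide_iff)
qed

text \<open>
  In terms of eigenvalues this is \<open>t\<^sup>2 \<le> t\<close> on \<open>[0, 1]\<close>. Without diagonalising \<open>S\<close>, it follows from
  \<open>0 \<le> (1 - S) S (1 - S) = S - 2 S\<^sup>2 + S\<^sup>3\<close> and \<open>S\<^sup>3 \<le> S\<^sup>2\<close>, evaluated at each unit vector.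
\<close>
lemma psd_contraction_frob_le_trace:
  assumes S: "S \<in> carrier_mat k k" and symm: "transpose_mat S = S"
    and psd: "\<And>x. x \<in> carrier_vec k \<Longrightarrow> 0 \<le> scalar_prod x (S *\<^sub>v x)"
    and contr: "\<And>x. x \<in> carrier_vec k \<Longrightarrow> scalar_prod x (S *\<^sub>v x) \<le> scalar_prod x x"
  shows "frob_inner S S \<le> frob_inner S (1\<^sub>m k)"
proof -
  have "(\<Sum>j<k. (S $$ (j, i))\<^sup>2) \<le> S $$ (i, i)" if i: "i < k" for i
  proof -
    define x y where "x = (unit_vec k i :: real vec)" and "y = S *\<^sub>v x"
    have x: "x \<in> carrier_vec k" and y: "y \<in> carrier_vec k"
      using S by (auto simp: x_def y_def intro!: mult_mat_vec_carrier[of _ k k])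
    have Sy: "S *\<^sub>v y \<in> carrier_vec k"
      using S y by (rule mult_mat_vec_carrier)
    have yi: "y = col S i"
      unfolding y_def x_def using S i by (intro eq_vecI) auto
    have "0 \<le> scalar_prod (x - y) (S *\<^sub>v (x - y))"
      using x y by (intro psd) auto
    also have "S *\<^sub>v (x - y) = y - S *\<^sub>v y"
      using S x y by (simp add: mult_minus_distrib_mat_vec[of S k k] y_def)
    also have "scalar_prod (x - y) (y - S *\<^sub>v y)
        = scalar_prod x y - scalar_prod x (S *\<^sub>v y) - (scalar_prod y y - scalar_prod y (S *\<^sub>v y))"
      using x y Sy by (simp add: minus_scalar_prod_distrib[of _ k] scalar_prod_minus_distrib[of _ k])
    also have "scalar_prod x (S *\<^sub>v y) = scalar_prod y y"
      using transpose_vec_mult_scalar[OF S y x] unfolding symm y_def by (rule sym)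
    finally have "scalar_prod y y \<le> scalar_prod x y"
      using contr[OF y] by linarith
    then show ?thesis
      using S i unfolding scalar_prod_self_eq x_def by (simp add: yi)
  qed
  then have "(\<Sum>i<k. \<Sum>j<k. (S $$ (j, i))\<^sup>2) \<le> (\<Sum>i<k. S $$ (i, i))"
    by (intro sum_mono) auto
  then show ?thesis
    using S unfolding frob_inner_one_right[OF S] by (subst (asm) sum.swap) (simp add: frob_inner_def power2_eq_square)
qed

lemma frob_inner_self_isometry:
  assumes "V \<in> carrier_mat N k" "transpose_mat V * V = 1\<^sub>m k"
  shows "frob_inner V V = real k"
proof -
  have "frob_inner V (V * 1\<^sub>m k) = frob_inner (transpose_mat V * V) (1\<^sub>m k)"
    using assms(1) by (intro frob_inner_mult_right[of _ N k]) auto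
  also have "\<dots> = real k"
    unfolding assms(2) by (subst frob_inner_one_right) auto
  finally show ?thesis
    using assms(1) by simp
qed

lemma isometry_mult:
  fixes V :: "real mat"
  assumes "V \<in> carrier_mat N k" "transpose_mat V * V = 1\<^sub>m k" "Q \<in> orthogonal_mats k"
  shows "transpose_mat (V * Q) * (V * Q) = 1\<^sub>m k"
proof -
  have Q: "Q \<in> carrier_mat k k" "transpose_mat Q * Q = 1\<^sub>m k"
    using assms(3) by (auto simp: orthogonal_mats_def)
  have "transpose_mat (V * Q) * (V * Q) = transpose_mat Q * (transpose_mat V * V) * Q"
    using assms(1) Q by (simp add: transpose_mult[of V N k Q k] assoc_mult_mat[of _ _ N _ k _ k]
        assoc_mult_mat[of _ k k _ k _ k] assoc_mult_mat[of _ k k _ N _ k])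
  then show ?thesis
    using Q assms(2) by simp
qed

lemma isometry_scalar_prod:
  fixes V :: "real mat"
  assumes "V \<in> carrier_mat N k" "transpose_mat V * V = 1\<^sub>m k" "x \<in> carrier_vec k"
  shows "scalar_prod (V *\<^sub>v x) (V *\<^sub>v x) = scalar_prod x x"
proof -
  have "scalar_prod (V *\<^sub>v x) (V *\<^sub>v x) = scalar_prod (transpose_mat V *\<^sub>v (V *\<^sub>v x)) x"
    using transpose_vec_mult_scalar[of V N k x "V *\<^sub>v x"] assms by simp
  also have "transpose_mat V *\<^sub>v (V *\<^sub>v x) = x"
    using assms assoc_mult_mat_vec[of "transpose_mat V" k N V k x] by simp
  finally show ?thesis .
qed

lemma scalar_prod_le_mean:
  fixes a b :: "real vec"
  assumes "a \<in> carrier_vec n" "b \<in> carrier_vec n"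
  shows "scalar_prod a b \<le> (scalar_prod a a + scalar_prod b b) / 2"
proof -
  have "0 \<le> scalar_prod (a - b) (a - b)"
    by (rule scalar_prod_self_nonneg)
  also have "\<dots> = scalar_prod a a - 2 * scalar_prod a b + scalar_prod b b"
    using assms by (simp add: minus_scalar_prod_distrib[of _ n] scalar_prod_minus_distrib[of _ n]
        comm_scalar_prod[of b n a])
  finally show ?thesis
    by simp
qed

text \<open>Minimising the distance thus means maximising the alignment \<open>\<langle>V\<^sup>T W, R\<rangle>\<close>.\<close>
lemma procrustes_distance:
  assumes V: "V \<in> carrier_mat N k" "transpose_mat V * V = 1\<^sub>m k"
    and W: "W \<in> carrier_mat N k" "transpose_mat W * W = 1\<^sub>m k"
    and R: "R \<in> orthogonal_mats k"
  shows "(frob_norm (W - V * R))\<^sup>2 = 2 * real k - 2 * frob_inner (transpose_mat V * W) R"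
proof -
  have Rc: "R \<in> carrier_mat k k" and VR: "V * R \<in> carrier_mat N k"
    using R V by (auto simp: orthogonal_mats_def)
  have "(frob_norm (W - V * R))\<^sup>2 = frob_inner W W - 2 * frob_inner W (V * R) + frob_inner (V * R) (V * R)"
    unfolding frob_norm_sq using frob_inner_minus_left[OF minus_carrier_mat[OF VR] W(1) VR, of W]
      frob_inner_minus_right[OF W(1) W(1) VR] frob_inner_minus_right[OF VR W(1) VR]
      frob_inner_commute[OF VR W(1)] by simp
  also have "frob_inner W (V * R) = frob_inner (transpose_mat V * W) R"
    by (rule frob_inner_mult_right[OF W(1) V(1) Rc])
  also have "frob_inner W W = k"
    by (rule frob_inner_self_isometry[OF W])
  also have "frob_inner (V * R) (V * R) = k"
    by (rule frob_inner_self_isometry[OF VR isometry_mult[OF V R]])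
  finally show ?thesis
    by simp
qed

text \<open>
  The optimum equals \<open>2 k\<close> minus twice the nuclear norm of \<open>M = V\<^sup>T W\<close>, and the nuclear norm
  dominates the squared Frobenius norm as the singular values of \<open>M\<close> are at most 1. The singular
  value decomposition is avoided: optimality of \<open>Q\<close> makes \<open>Q\<^sup>T M\<close> the positive semidefinite polar
  factor of \<open>M\<close>.
\<close>
lemma procrustes_optimum_bound:
  assumes V: "V \<in> carrier_mat N k" "transpose_mat V * V = 1\<^sub>m k"
    and W: "W \<in> carrier_mat N k" "transpose_mat W * W = 1\<^sub>m k"
    and Q: "is_arg_min (\<lambda>R. frob_norm (W - V * R)) (\<lambda>R. R \<in> orthogonal_mats k) Q"
  shows "(frob_norm (W - V * Q))\<^sup>2
    \<le> 2 * real k - 2 * frob_inner (transpose_mat V * W) (transpose_mat V * W)"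
proof -
  define M where "M = transpose_mat V * W"
  define S where "S = transpose_mat Q * M"
  have QO: "Q \<in> orthogonal_mats k"
    and Qmin: "\<And>R. R \<in> orthogonal_mats k \<Longrightarrow> frob_norm (W - V * Q) \<le> frob_norm (W - V * R)"
    using Q by (auto simp: is_arg_min_def not_less)
  have Qc: "Q \<in> carrier_mat k k" and M: "M \<in> carrier_mat k k" and S: "S \<in> carrier_mat k k"
    using QO V W by (auto simp: orthogonal_mats_def M_def S_def)
  have opt: "frob_inner S G \<le> frob_inner S (1\<^sub>m k)" if G: "G \<in> orthogonal_mats k" for G
  proof -
    have Gc: "G \<in> carrier_mat k k"
      using G by (simp add: orthogonal_mats_def)
    have QG: "Q * G \<in> orthogonal_mats k"
      by (rule orthogonal_mats_mult[OF QO G])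
    have "(frob_norm (W - V * Q))\<^sup>2 \<le> (frob_norm (W - V * (Q * G)))\<^sup>2"
      by (intro power_mono Qmin QG frob_norm_nonneg)
    then have "frob_inner M (Q * G) \<le> frob_inner M Q"
      unfolding procrustes_distance[OF V W QG] procrustes_distance[OF V W QO] M_def by simp
    moreover have "frob_inner M (Q * G) = frob_inner S G"
      unfolding S_def by (rule frob_inner_mult_right[OF M Qc Gc])
    moreover have "frob_inner M (Q * 1\<^sub>m k) = frob_inner S (1\<^sub>m k)"
      unfolding S_def by (rule frob_inner_mult_right[OF M Qc]) simp
    ultimately show ?thesis
      using Qc by simp
  qed
  have contr: "scalar_prod y (S *\<^sub>v y) \<le> scalar_prod y y" if y: "y \<in> carrier_vec k" for y
  proof -
    have VQ: "V * Q \<in> carrier_mat N k" and Wy: "W *\<^sub>v y \<in> carrier_vec N"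
      using V Qc W y by (auto intro!: mult_mat_vec_carrier[of _ N k])
    have "S = transpose_mat (V * Q) * W"
      unfolding S_def M_def using V W Qc
      by (simp add: transpose_mult[of V N k Q k] assoc_mult_mat[of _ k k _ N _ k])
    then have "scalar_prod y (S *\<^sub>v y) = scalar_prod y (transpose_mat (V * Q) *\<^sub>v (W *\<^sub>v y))"
      using VQ W y by (simp add: assoc_mult_mat_vec[of _ k N _ k])
    also have "\<dots> = scalar_prod ((V * Q) *\<^sub>v y) (W *\<^sub>v y)"
      using transpose_vec_mult_scalar[of "transpose_mat (V * Q)" k N "W *\<^sub>v y" y] VQ Wy y by simp
    also have "\<dots> \<le> (scalar_prod ((V * Q) *\<^sub>v y) ((V * Q) *\<^sub>v y) + scalar_prod (W *\<^sub>v y) (W *\<^sub>v y)) / 2"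
      using VQ W(1) Wy y by (intro scalar_prod_le_mean[of _ N] mult_mat_vec_carrier[of _ N k]) auto
    also have "\<dots> = scalar_prod y y"
      using isometry_scalar_prod[OF VQ isometry_mult[OF V QO] y] isometry_scalar_prod[OF W y] by simp
    finally show ?thesis .
  qed
  have "frob_inner S S = frob_inner (Q * S) M"
    using frob_inner_mult_right[of S k k "transpose_mat Q" k M] S Qc M by (simp flip: S_def)
  also have "Q * S = (Q * transpose_mat Q) * M"
    unfolding S_def using Qc M by (simp add: assoc_mult_mat[of _ k k _ k _ k])
  also have "\<dots> = M"
    using M by (simp add: orthogonal_mats_mult_transpose[OF QO])
  finally have "frob_inner M M \<le> frob_inner S (1\<^sub>m k)"
    using psd_contraction_frob_le_trace[OF S identity_alignment_optimal_imp_symmetric[OF S opt]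
        identity_alignment_optimal_imp_psd[OF S opt] contr] by simp
  also have "frob_inner S (1\<^sub>m k) = frob_inner M Q"
    using frob_inner_mult_right[OF M Qc, of "1\<^sub>m k"] Qc by (simp add: S_def)
  finally show ?thesis
    unfolding procrustes_distance[OF V W QO] by (simp add: M_def)
qed

section \<open>Orthonormal eigenbases\<close>

lemma first_cols_carrier [simp]: "first_cols N k v \<in> carrier_mat N k"
  by (auto simp: first_cols_def)

lemma first_cols_dim [simp]:
  "dim_row (first_cols N k v) = N" "dim_col (first_cols N k v) = k"
  by (simp_all add: first_cols_def)

lemma first_cols_index [simp]:
  "i < N \<Longrightarrow> j < k \<Longrightarrow> first_cols N k v $$ (i, j) = vec_index (v j) i"
  by (simp add: first_cols_def mat_of_cols_index)

lemma eigenbasis_carrier: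
  assumes "A \<in> carrier_mat N N" "ordered_orthonormal_eigenbasis A lam v" "i < N"
  shows "v i \<in> carrier_vec N"
  using assms by (auto simp: ordered_orthonormal_eigenbasis_def eigenvector_def)

lemma transpose_first_cols_mult:
  assumes "\<And>i. i < k \<Longrightarrow> v i \<in> carrier_vec N" "\<And>j. j < l \<Longrightarrow> w j \<in> carrier_vec N" "i < k" "j < l"
  shows "(transpose_mat (first_cols N k v) * first_cols N l w) $$ (i, j) = scalar_prod (v i) (w j)"
  using assms
  by (simp add: index_mult_mat_sum[of _ k N _ l] scalar_prod_def atLeast0LessThan carrier_vecD[OF assms(2)])

lemma first_cols_isometry:
  assumes "A \<in> carrier_mat N N" "ordered_orthonormal_eigenbasis A lam v" "k \<le> N"
  shows "transpose_mat (first_cols N k v) * first_cols N k v = 1\<^sub>m k"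
proof (rule eq_matI)
  fix i j assume "i < dim_row (1\<^sub>m k :: real mat)" "j < dim_col (1\<^sub>m k :: real mat)"
  then have ij: "i < k" "j < k"
    by auto
  have "(transpose_mat (first_cols N k v) * first_cols N k v) $$ (i, j) = scalar_prod (v i) (v j)"
    using assms ij eigenbasis_carrier[OF assms(1,2)] by (intro transpose_first_cols_mult) auto
  then show "(transpose_mat (first_cols N k v) * first_cols N k v) $$ (i, j) = 1\<^sub>m k $$ (i, j)"
    using assms ij by (auto simp: ordered_orthonormal_eigenbasis_def)
qed (auto simp: carrier_matD[OF first_cols_carrier])

lemma eigenbasis_orthogonal_mat:
  assumes "A \<in> carrier_mat N N" "ordered_orthonormal_eigenbasis A lam v"
  shows "first_cols N N v \<in> orthogonal_mats N"
  using first_cols_isometry[OF assms order_refl] by (simp add: orthogonal_mats_def)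

lemma eigenbasis_parseval:
  assumes A: "A \<in> carrier_mat N N" "ordered_orthonormal_eigenbasis A lam v" and x: "x \<in> carrier_vec N"
  shows "(\<Sum>i<N. (scalar_prod (v i) x)\<^sup>2) = scalar_prod x x"
proof -
  let ?U = "first_cols N N v"
  have U: "?U \<in> carrier_mat N N"
    by simp
  have col_U: "col ?U i = v i" if "i < N" for i
    using that eigenbasis_carrier[OF A that] U by (intro eq_vecI) (auto simp: carrier_matD[OF U])
  have "scalar_prod (transpose_mat ?U *\<^sub>v x) (transpose_mat ?U *\<^sub>v x) = scalar_prod x x"
    using orthogonal_mats_mult_transpose[OF eigenbasis_orthogonal_mat[OF A]] x
    by (intro isometry_scalar_prod[of _ N N]) auto
  then show ?thesis
    unfolding scalar_prod_self_eq using U by (simp add: col_U carrier_matD[OF U] scalar_prod_self_eq)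
qed

lemma eigen_decomposition:
  assumes A: "A \<in> carrier_mat N N" and v: "ordered_orthonormal_eigenbasis A lam v"
  shows "A = first_cols N N v * mat_diag N lam * transpose_mat (first_cols N N v)"
proof -
  let ?U = "first_cols N N v"
  have U: "?U \<in> carrier_mat N N"
    by simp
  have AU: "A * ?U = ?U * mat_diag N lam"
  proof (rule eq_matI)
    fix i j assume "i < dim_row (?U * mat_diag N lam)" "j < dim_col (?U * mat_diag N lam)"
    then have ij: "i < N" "j < N"
      using U by (auto simp: carrier_matD[OF mat_diag_dim])
    have c: "v j \<in> carrier_vec N"
      by (rule eigenbasis_carrier[OF A v ij(2)])
    have "(A * ?U) $$ (i, j) = (\<Sum>l<N. A $$ (i, l) * vec_index (v j) l)"
      using ij A by (simp add: index_mult_mat_sum[of A N N ?U N] del: index_mult_mat(1))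
    also have "\<dots> = vec_index (A *\<^sub>v v j) i"
      using ij A c by (simp add: scalar_prod_def atLeast0LessThan)
    also have "A *\<^sub>v v j = lam j \<cdot>\<^sub>v v j"
      using v A ij by (auto simp: ordered_orthonormal_eigenbasis_def eigenvector_def)
    also have "vec_index \<dots> i = (?U * mat_diag N lam) $$ (i, j)"
      using ij c by (simp add: mat_diag_mult_right[OF U] mult.commute)
    finally show "(A * ?U) $$ (i, j) = (?U * mat_diag N lam) $$ (i, j)" .
  qed (use A U in \<open>auto simp: carrier_matD[OF mat_diag_dim]\<close>)
  have "A = A * (?U * transpose_mat ?U)"
    using A by (simp add: orthogonal_mats_mult_transpose[OF eigenbasis_orthogonal_mat[OF A v]])
  also have "\<dots> = A * ?U * transpose_mat ?U"
    using A U by (simp add: assoc_mult_mat[of _ N N _ N _ N])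
  finally show ?thesis
    unfolding AU .
qed

text \<open>
  Expanding the projector onto the span of the \<open>w j\<close> in the eigenbasis weights each eigenvalue
  \<open>lam i\<close> by the squared length of the projection of \<open>v i\<close>.
\<close>
lemma frob_inner_eigenbasis_projector:
  assumes A: "A \<in> carrier_mat N N" "ordered_orthonormal_eigenbasis A lam v"
    and w: "\<And>j. j < k \<Longrightarrow> w j \<in> carrier_vec N"
  shows "frob_inner A (first_cols N k w * transpose_mat (first_cols N k w))
    = (\<Sum>i<N. lam i * (\<Sum>j<k. (scalar_prod (v i) (w j))\<^sup>2))"
proof -
  let ?U = "first_cols N N v" and ?W = "first_cols N k w" and ?L = "mat_diag N lam"
  define Y where "Y = transpose_mat ?U * ?W"
  have c: "?U \<in> carrier_mat N N" "?W \<in> carrier_mat N k" "?L \<in> carrier_mat N N" "Y \<in> carrier_mat N k"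
    unfolding Y_def by (auto intro!: mult_carrier_mat[of _ k N] mult_carrier_mat[of _ N N])
  have "frob_inner A (?W * transpose_mat ?W) = frob_inner (A * ?W) ?W"
    using frob_inner_mult_right'[of A N N ?W k "transpose_mat ?W"] A(1) c by simp
  also have "A * ?W = ?U * (?L * Y)"
    unfolding Y_def using c
    by (subst eigen_decomposition[OF A])
      (simp only: assoc_mult_mat[OF mult_carrier_mat[OF c(1,3)] transpose_carrier_mat[THEN iffD2, OF c(1)] c(2)]
        assoc_mult_mat[OF c(1,3) c(4)[unfolded Y_def]])
  also have "frob_inner (?U * (?L * Y)) ?W = frob_inner (?L * Y) Y"
    using frob_inner_mult_left[OF c(1) mult_carrier_mat[OF c(3,4)] c(2)] unfolding Y_def .
  also have "\<dots> = (\<Sum>i<N. lam i * (\<Sum>j<k. (Y $$ (i, j))\<^sup>2))"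
    unfolding frob_inner_def mat_diag_mult_left[OF c(4)]
    by (simp add: sum_distrib_left power2_eq_square mult.assoc)
  also have "\<dots> = (\<Sum>i<N. lam i * (\<Sum>j<k. (scalar_prod (v i) (w j))\<^sup>2))"
    unfolding Y_def using w eigenbasis_carrier[OF A]
    by (intro sum.cong refl arg_cong2[of _ _ _ _ "(*)"])
      (simp add: transpose_first_cols_mult del: index_mult_mat)
  finally show ?thesis .
qed

section \<open>Perturbation of leading eigenspaces\<close>

text \<open>
  Moving weight \<open>k - (\<Sum>i<k. c i)\<close> from the first \<open>k\<close> indices to later ones costs at least the jump
  of \<open>lam\<close> at \<open>k\<close> per unit of weight.
\<close>
lemma weighted_sum_gap:
  fixes lam c :: "nat \<Rightarrow> real"
  assumes k: "1 \<le> k" "k < N"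
    and decr: "\<And>i j. i \<le> j \<Longrightarrow> j < N \<Longrightarrow> lam j \<le> lam i"
    and c: "\<And>i. i < N \<Longrightarrow> 0 \<le> c i" "\<And>i. i < N \<Longrightarrow> c i \<le> 1" "(\<Sum>i<N. c i) = real k"
  shows "(lam (k - 1) - lam k) * (real k - (\<Sum>i<k. c i)) \<le> (\<Sum>i<k. lam i) - (\<Sum>i<N. lam i * c i)"
proof -
  have split: "(\<Sum>i<N. f i) = (\<Sum>i<k. f i) + (\<Sum>i=k..<N. f i)" for f :: "nat \<Rightarrow> real"
    using k sum.atLeastLessThan_concat[of 0 k N f] by (simp add: atLeast0LessThan)
  have "lam (k - 1) * (real k - (\<Sum>i<k. c i)) = (\<Sum>i<k. lam (k - 1) * (1 - c i))"
    by (simp add: sum_subtractf right_diff_distrib flip: sum_distrib_left)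
  also have "\<dots> \<le> (\<Sum>i<k. lam i * (1 - c i))"
    using k c decr by (intro sum_mono mult_right_mono) auto
  finally have upper: "lam (k - 1) * (real k - (\<Sum>i<k. c i)) \<le> (\<Sum>i<k. lam i) - (\<Sum>i<k. lam i * c i)"
    by (simp add: sum_subtractf right_diff_distrib)
  have "(\<Sum>i=k..<N. lam i * c i) \<le> (\<Sum>i=k..<N. lam k * c i)"
    using k c decr by (intro sum_mono mult_right_mono) auto
  also have "\<dots> = lam k * (real k - (\<Sum>i<k. c i))"
    using split[of c] c(3) by (simp flip: sum_distrib_left)
  finally show ?thesis
    using upper split[of "\<lambda>i. lam i * c i"] by (simp add: left_diff_distrib)
qed

text \<open>
  Ky Fan's maximum principle with a quantitative gain. The weights \<open>c i\<close> in the expansion of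
  \<open>W W\<^sup>T\<close> are at most 1 and sum to \<open>k\<close>, by Parseval's identity in each of the two bases.
\<close>
lemma eigenspace_energy_gap:
  assumes A: "A \<in> carrier_mat N N" "ordered_orthonormal_eigenbasis A lam v"
    and A': "A' \<in> carrier_mat N N" "ordered_orthonormal_eigenbasis A' lam' w"
    and k: "1 \<le> k" "k < N"
  defines "V \<equiv> first_cols N k v" and "W \<equiv> first_cols N k w"
  defines "D \<equiv> real k - frob_inner (transpose_mat V * W) (transpose_mat V * W)"
  shows "(lam (k - 1) - lam k) * D
      \<le> frob_inner A (V * transpose_mat V) - frob_inner A (W * transpose_mat W)"
    and "0 \<le> D"
proof -
  define c where "c i = (\<Sum>j<k. (scalar_prod (v i) (w j))\<^sup>2)" for i
  have v: "v i \<in> carrier_vec N" and w: "w i \<in> carrier_vec N" if "i < N" for i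
    using eigenbasis_carrier[OF A that] eigenbasis_carrier[OF A' that] by auto
  have vv: "scalar_prod (v i) (v j) = (if i = j then 1 else 0)" if "i < N" "j < N" for i j
    using A that by (auto simp: ordered_orthonormal_eigenbasis_def)
  have ww: "scalar_prod (w i) (w j) = (if i = j then 1 else 0)" if "i < N" "j < N" for i j
    using A' that by (auto simp: ordered_orthonormal_eigenbasis_def)
  have M: "frob_inner (transpose_mat V * W) (transpose_mat V * W) = (\<Sum>i<k. c i)"
    unfolding c_def V_def W_def frob_inner_def using k v w
    by (simp add: transpose_first_cols_mult power2_eq_square carrier_matD[OF first_cols_carrier]
        del: index_mult_mat(1))
  have c0: "0 \<le> c i" for i
    by (simp add: c_def sum_nonneg)
  have c1: "c i \<le> 1" if "i < N" for i
  proof -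
    have "c i \<le> (\<Sum>j<N. (scalar_prod (v i) (w j))\<^sup>2)"
      unfolding c_def using k by (intro sum_mono2) auto
    also have "\<dots> = (\<Sum>j<N. (scalar_prod (w j) (v i))\<^sup>2)"
      using v[OF that] w by (intro sum.cong refl) (simp add: comm_scalar_prod[of _ N])
    also have "\<dots> = 1"
      using eigenbasis_parseval[OF A' v[OF that]] vv[OF that that] by simp
    finally show ?thesis .
  qed
  have "(\<Sum>i<N. c i) = (\<Sum>j<k. \<Sum>i<N. (scalar_prod (v i) (w j))\<^sup>2)"
    unfolding c_def by (rule sum.swap)
  also have "\<dots> = (\<Sum>j<k. 1)"
    using k w ww by (intro sum.cong refl) (simp add: eigenbasis_parseval[OF A])
  finally have csum: "(\<Sum>i<N. c i) = real k"
    by simp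
  have AW: "frob_inner A (W * transpose_mat W) = (\<Sum>i<N. lam i * c i)"
    unfolding W_def c_def using k w by (intro frob_inner_eigenbasis_projector[OF A]) auto
  have "frob_inner A (V * transpose_mat V) = (\<Sum>i<N. lam i * (\<Sum>j<k. (scalar_prod (v i) (v j))\<^sup>2))"
    unfolding V_def using k v by (intro frob_inner_eigenbasis_projector[OF A]) auto
  also have "\<dots> = (\<Sum>i<N. if i \<in> {..<k} then lam i else 0)"
  proof (intro sum.cong refl)
    fix i assume "i \<in> {..<N}"
    then have "(\<Sum>j<k. (scalar_prod (v i) (v j))\<^sup>2) = (\<Sum>j<k. if j = i then 1 else 0)"
      using k by (intro sum.cong refl) (auto simp: vv)
    then show "lam i * (\<Sum>j<k. (scalar_prod (v i) (v j))\<^sup>2) = (if i \<in> {..<k} then lam i else 0)"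
      by simp
  qed
  also have "\<dots> = (\<Sum>i<k. lam i)"
    using k by (intro sum.mono_neutral_cong_right) auto
  finally have AV: "frob_inner A (V * transpose_mat V) = (\<Sum>i<k. lam i)" .
  show "(lam (k - 1) - lam k) * D
      \<le> frob_inner A (V * transpose_mat V) - frob_inner A (W * transpose_mat W)"
    unfolding D_def M AW AV using A c0 c1 csum k
    by (intro weighted_sum_gap) (auto simp: ordered_orthonormal_eigenbasis_def)
  have "(\<Sum>i<k. c i) \<le> (\<Sum>i<k. 1)"
    using k by (intro sum_mono c1) auto
  then show "0 \<le> D"
    unfolding D_def M by simp
qed

lemma projector_distance:
  assumes V: "V \<in> carrier_mat N k" "transpose_mat V * V = 1\<^sub>m k"
    and W: "W \<in> carrier_mat N k" "transpose_mat W * W = 1\<^sub>m k"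
  shows "(frob_norm (V * transpose_mat V - W * transpose_mat W))\<^sup>2
    = 2 * real k - 2 * frob_inner (transpose_mat V * W) (transpose_mat V * W)"
proof -
  have inner: "frob_inner (X * transpose_mat X) (Y * transpose_mat Y)
      = frob_inner (transpose_mat X * Y) (transpose_mat X * Y)"
    if X: "X \<in> carrier_mat N k" and Y: "Y \<in> carrier_mat N k" for X Y
  proof -
    have "frob_inner (X * transpose_mat X) (Y * transpose_mat Y) = frob_inner (X * transpose_mat X * Y) Y"
      using frob_inner_mult_right'[of "X * transpose_mat X" N N Y k "transpose_mat Y"] X Y by simp
    also have "X * transpose_mat X * Y = X * (transpose_mat X * Y)"
      using X Y by (simp add: assoc_mult_mat[of _ N k _ N _ k])
    also have "frob_inner \<dots> Y = frob_inner (transpose_mat X * Y) (transpose_mat X * Y)"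
      using X Y by (intro frob_inner_mult_left[of _ N k _ k]) auto
    finally show ?thesis .
  qed
  have one: "frob_inner (1\<^sub>m k) (1\<^sub>m k) = real k"
    by (subst frob_inner_one_right) auto
  have P: "V * transpose_mat V \<in> carrier_mat N N" "W * transpose_mat W \<in> carrier_mat N N"
    using V W by auto
  show ?thesis
    unfolding frob_norm_sq
    using frob_inner_minus_left[OF minus_carrier_mat[OF P(2)] P(1) P(2), of "V * transpose_mat V"]
      frob_inner_minus_right[OF P(1) P(1) P(2)] frob_inner_minus_right[OF P(2) P(1) P(2)]
      frob_inner_commute[OF P(2) P(1)] inner[OF V(1) V(1)] inner[OF W(1) W(1)] inner[OF V(1) W(1)]
    by (simp add: V W one)
qed

text \<open>
  A Davis--Kahan bound that needs the spectral gap of one matrix only. The other matrix enters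
  through the mere maximality of its own leading eigenspace.
\<close>
lemma aligned_eigenvectors_perturbation:
  assumes A: "A \<in> carrier_mat N N" "ordered_orthonormal_eigenbasis A lam v"
    and A': "A' \<in> carrier_mat N N" "ordered_orthonormal_eigenbasis A' lam' w"
    and k: "1 \<le> k" "k < N"
    and gap: "0 < \<alpha>" "\<alpha> \<le> lam (k - 1) - lam k"
    and Q: "is_arg_min (\<lambda>R. frob_norm (first_cols N k w - first_cols N k v * R))
              (\<lambda>R. R \<in> orthogonal_mats k) Q"
  shows "frob_norm (first_cols N k w - first_cols N k v * Q) \<le> 2 * frob_norm (A - A') / \<alpha>"
proof -
  define V W where "V = first_cols N k v" and "W = first_cols N k w"
  define D where "D = real k - frob_inner (transpose_mat V * W) (transpose_mat V * W)"
  define d where "d = frob_norm (V * transpose_mat V - W * transpose_mat W)"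
  have V: "V \<in> carrier_mat N k" "transpose_mat V * V = 1\<^sub>m k"
    unfolding V_def using first_cols_isometry[OF A] k by auto
  have W: "W \<in> carrier_mat N k" "transpose_mat W * W = 1\<^sub>m k"
    unfolding W_def using first_cols_isometry[OF A'] k by auto
  have P: "V * transpose_mat V \<in> carrier_mat N N" "W * transpose_mat W \<in> carrier_mat N N"
    using V W by auto
  have d: "d\<^sup>2 = 2 * D" "0 \<le> d"
    unfolding d_def D_def projector_distance[OF V W] by (auto simp: frob_norm_nonneg)
  have "\<alpha> * D \<le> (lam (k - 1) - lam k) * D"
    using gap eigenspace_energy_gap(2)[OF A A' k] unfolding D_def V_def W_def by (intro mult_right_mono)
  also have "\<dots> \<le> frob_inner A (V * transpose_mat V) - frob_inner A (W * transpose_mat W)"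
    unfolding D_def V_def W_def by (rule eigenspace_energy_gap(1)[OF A A' k])
  finally have energy: "\<alpha> * D \<le> frob_inner A (V * transpose_mat V) - frob_inner A (W * transpose_mat W)" .
  have "0 \<le> lam' (k - 1) - lam' k"
    using A' k by (auto simp: ordered_orthonormal_eigenbasis_def)
  then have energy': "0 \<le> frob_inner A' (W * transpose_mat W) - frob_inner A' (V * transpose_mat V)"
    using eigenspace_energy_gap[OF A' A k] mult_nonneg_nonneg unfolding V_def W_def by (meson order_trans)
  have "\<alpha> * D \<le> frob_inner (A - A') (V * transpose_mat V - W * transpose_mat W)"
    using energy energy' A(1) A'(1) P
    by (simp add: frob_inner_minus_right[OF minus_carrier_mat[OF A'(1)] P]
        frob_inner_minus_left[OF P(1) A(1) A'(1)] frob_inner_minus_left[OF P(2) A(1) A'(1)])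
  also have "\<dots> \<le> frob_norm (A - A') * d"
    unfolding d_def
    by (rule frob_inner_Cauchy_Schwarz[OF minus_carrier_mat[OF A'(1)] minus_carrier_mat[OF P(2)]])
  finally have "\<alpha> * D \<le> frob_norm (A - A') * d" .
  moreover have "\<alpha> * d * d = 2 * (\<alpha> * D)"
    using d(1) by (simp add: power2_eq_square)
  ultimately have "\<alpha> * d * d \<le> 2 * frob_norm (A - A') * d"
    by linarith
  then have "\<alpha> * d \<le> 2 * frob_norm (A - A')"
    using d(2) frob_norm_nonneg[of "A - A'"] by (cases "d = 0") (auto simp: mult_le_cancel_right)
  then have dle: "d \<le> 2 * frob_norm (A - A') / \<alpha>"
    using gap by (simp add: field_simps)
  have "(frob_norm (W - V * Q))\<^sup>2 \<le> d\<^sup>2"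
    using procrustes_optimum_bound[OF V W] Q unfolding d D_def V_def W_def by simp
  then have "frob_norm (W - V * Q) \<le> d"
    using d(2) by (rule power2_le_imp_le)
  with dle show ?thesis
    unfolding V_def W_def by simp
qed

lemma row_first_cols_norm_le_one:
  assumes A: "A \<in> carrier_mat N N" "ordered_orthonormal_eigenbasis A lam v"
    and "k \<le> N" "i < N"
  shows "scalar_prod (row (first_cols N k v) i) (row (first_cols N k v) i) \<le> 1"
proof -
  have "scalar_prod (row (first_cols N k v) i) (row (first_cols N k v) i) = (\<Sum>j<k. (vec_index (v j) i)\<^sup>2)"
    unfolding scalar_prod_self_eq using assms by (simp add: carrier_matD[OF first_cols_carrier])
  also have "\<dots> \<le> (\<Sum>j<N. (vec_index (v j) i)\<^sup>2)"
    using assms by (intro sum_mono2) auto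
  also have "\<dots> = (\<Sum>j<N. (scalar_prod (v j) (unit_vec N i))\<^sup>2)"
    using assms by simp
  also have "\<dots> = 1"
    using assms by (subst eigenbasis_parseval[OF A]) auto
  finally show ?thesis .
qed

text \<open>This makes the final bound trivial as soon as its right-hand side reaches 2.\<close>
lemma eigenvector_rows_distance_le_two:
  assumes A: "A \<in> carrier_mat N N" "ordered_orthonormal_eigenbasis A lam v"
    and A': "A' \<in> carrier_mat N N" "ordered_orthonormal_eigenbasis A' lam' w"
    and "k \<le> N" "i < N" and Q: "Q \<in> orthogonal_mats k"
  shows "vnorm (row (first_cols N k w) i - row (first_cols N k v * Q) i) \<le> 2"
proof -
  let ?V = "first_cols N k v" and ?W = "first_cols N k w"
  define a b where "a = row ?W i" and "b = row (?V * Q) i"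
  have Qc: "Q \<in> carrier_mat k k"
    using Q by (simp add: orthogonal_mats_def)
  have c: "a \<in> carrier_vec k" "b \<in> carrier_vec k" "row ?V i \<in> carrier_vec k"
    unfolding a_def b_def by (rule carrier_vecI, use Qc in simp)+
  have "b = transpose_mat Q *\<^sub>v row ?V i"
  proof (rule eq_vecI)
    fix j assume "j < dim_vec (transpose_mat Q *\<^sub>v row ?V i)"
    then have j: "j < k" "col Q j \<in> carrier_vec k"
      using Qc by (auto intro: col_carrier_vec)
    have "vec_index b j = scalar_prod (row ?V i) (col Q j)"
      unfolding b_def using Qc assms(6) j by simp
    also have "\<dots> = scalar_prod (col Q j) (row ?V i)"
      by (rule comm_scalar_prod[OF c(3) j(2)])
    also have "\<dots> = vec_index (transpose_mat Q *\<^sub>v row ?V i) j"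
      using Qc j by simp
    finally show "vec_index b j = vec_index (transpose_mat Q *\<^sub>v row ?V i) j" .
  qed (use Qc c in simp)
  then have "scalar_prod b b = scalar_prod (row ?V i) (row ?V i)"
    using isometry_scalar_prod[of "transpose_mat Q" k k "row ?V i"] Qc c(3)
      orthogonal_mats_mult_transpose[OF Q] by simp
  then have b: "scalar_prod b b \<le> 1"
    using row_first_cols_norm_le_one[OF A assms(5,6)] by simp
  have a: "scalar_prod a a \<le> 1"
    unfolding a_def by (rule row_first_cols_norm_le_one[OF A' assms(5,6)])
  have "0 \<le> scalar_prod (a + b) (a + b)"
    by (rule scalar_prod_self_nonneg)
  also have "\<dots> = scalar_prod a a + 2 * scalar_prod a b + scalar_prod b b"
    using c by (simp add: add_scalar_prod_distrib[of _ k] scalar_prod_add_distrib[of _ k] comm_scalar_prod[of b k a])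
  finally have "- 2 * scalar_prod a b \<le> 2"
    using a b by simp
  moreover have "scalar_prod (a - b) (a - b) = scalar_prod a a - 2 * scalar_prod a b + scalar_prod b b"
    using c by (simp add: minus_scalar_prod_distrib[of _ k] scalar_prod_minus_distrib[of _ k]
        comm_scalar_prod[of b k a])
  ultimately have "scalar_prod (a - b) (a - b) \<le> 2\<^sup>2"
    using a b by simp
  then show ?thesis
    unfolding vnorm_def a_def b_def by (rule real_le_lsqrt[rotated]) simp
qed

section \<open>Affinity matrices\<close>

lemma scaled_sqdist_refl [simp]: "scaled_sqdist \<sigma> z z = 0"
  by (simp add: scaled_sqdist_def vnorm_sq scalar_prod_def)

lemma scaled_sqdist_commute:
  assumes "u \<in> carrier_vec n" "w \<in> carrier_vec n"
  shows "scaled_sqdist \<sigma> u w = scaled_sqdist \<sigma> w u"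
  using assms unfolding scaled_sqdist_def vnorm_sq scalar_prod_self_eq
  by (simp add: power2_commute)

lemma scaled_sqdist_nonneg: "0 < \<sigma> \<Longrightarrow> 0 \<le> scaled_sqdist \<sigma> u w"
  by (simp add: scaled_sqdist_def)

lemma vertex_degree_eq:
  assumes "i < N"
  shows "vertex_degree \<sigma> N z i = (\<Sum>l<N. exp (- scaled_sqdist \<sigma> (z i) (z l)))"
  using assms by (simp add: vertex_degree_def weight_mat_def)

text \<open>Each vertex contributes its own weight 1.\<close>
lemma vertex_degree_ge_one:
  assumes "i < N"
  shows "1 \<le> vertex_degree \<sigma> N z i"
proof -
  have "exp (- scaled_sqdist \<sigma> (z i) (z i)) \<le> vertex_degree \<sigma> N z i"
    unfolding vertex_degree_eq[OF assms] using assms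
    by (intro member_le_sum[of i _ "\<lambda>l. exp (- scaled_sqdist \<sigma> (z i) (z l))"]) auto
  then show ?thesis
    by simp
qed

lemma affinity_mat_carrier [simp]: "affinity_mat \<sigma> N z \<in> carrier_mat N N"
  unfolding affinity_mat_def Let_def
  by (intro mult_carrier_mat[of _ N N] mat_diag_dim) (simp add: weight_mat_def)

lemma affinity_mat_index:
  assumes "i < N" "j < N"
  shows "affinity_mat \<sigma> N z $$ (i, j) = vertex_degree \<sigma> N z i powr (- 1 / 2)
    * exp (- scaled_sqdist \<sigma> (z i) (z j)) * vertex_degree \<sigma> N z j powr (- 1 / 2)"
proof -
  have W: "weight_mat \<sigma> N z \<in> carrier_mat N N"
    by (simp add: weight_mat_def)
  have c: "mat N N (\<lambda>(i, j). vertex_degree \<sigma> N z i powr (- 1 / 2) * weight_mat \<sigma> N z $$ (i, j)) \<in> carrier_mat N N"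
    by simp
  show ?thesis
    unfolding affinity_mat_def Let_def mat_diag_mult_left[OF W] mat_diag_mult_right[OF c]
    using assms by (simp add: weight_mat_def)
qed

lemma powr_neg_half_sq: "0 < (d::real) \<Longrightarrow> (d powr (- 1 / 2))\<^sup>2 = 1 / d"
proof -
  assume "0 < d"
  then have "(d powr (- 1 / 2))\<^sup>2 = d powr (- 1 / 2 + - 1 / 2)"
    by (simp only: power2_eq_square powr_add)
  also have "\<dots> = 1 / d"
    using \<open>0 < d\<close> by (simp add: powr_minus_divide)
  finally show ?thesis .
qed

lemma affinity_mat_le_one:
  assumes "0 < \<sigma>" "i < N" "j < N"
  shows "affinity_mat \<sigma> N z $$ (i, j) \<le> 1"
proof -
  have p: "vertex_degree \<sigma> N z l powr (- 1 / 2) \<le> 1" if "l < N" for l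
    using powr_mono2'[of "- 1 / 2" 1 "vertex_degree \<sigma> N z l"] vertex_degree_ge_one[OF that] by simp
  have e: "exp (- scaled_sqdist \<sigma> (z i) (z j)) \<le> 1"
    using scaled_sqdist_nonneg[OF assms(1)] by simp
  show ?thesis
    unfolding affinity_mat_index[OF assms(2,3)]
    by (intro mult_le_one p e assms mult_nonneg_nonneg) auto
qed

text \<open>
  Split each mixed term by \<open>2 g\<^sub>i g\<^sub>j \<le> g\<^sub>i\<^sup>2 + g\<^sub>j\<^sup>2\<close> and use the symmetry of the weights: the row sums
  that appear are the degrees, which cancel the normalisation.
\<close>
lemma affinity_quadratic_form_le:
  assumes z: "\<And>i. i < N \<Longrightarrow> z i \<in> carrier_vec n" and u: "u \<in> carrier_vec N"
  shows "scalar_prod u (affinity_mat \<sigma> N z *\<^sub>v u) \<le> scalar_prod u u"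
proof -
  define p where "p i = vertex_degree \<sigma> N z i powr (- 1 / 2)" for i
  define e where "e i j = exp (- scaled_sqdist \<sigma> (z i) (z j))" for i j
  define g where "g i = p i * vec_index u i" for i
  have e_sym: "e i j = e j i" if "i < N" "j < N" for i j
    unfolding e_def using scaled_sqdist_commute z that by metis
  have deg: "(\<Sum>j<N. e i j * (g i)\<^sup>2) = (vec_index u i)\<^sup>2" if i: "i < N" for i
  proof -
    have pos: "0 < vertex_degree \<sigma> N z i"
      using vertex_degree_ge_one[OF i, of \<sigma> z] by linarith
    have "(g i)\<^sup>2 = 1 / vertex_degree \<sigma> N z i * (vec_index u i)\<^sup>2"
      unfolding g_def p_def power_mult_distrib powr_neg_half_sq[OF pos] ..
    then have "vertex_degree \<sigma> N z i * (g i)\<^sup>2 = (vec_index u i)\<^sup>2"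
      using pos by simp
    then show ?thesis
      unfolding vertex_degree_eq[OF i] e_def sum_distrib_right .
  qed
  have "scalar_prod u (affinity_mat \<sigma> N z *\<^sub>v u)
      = (\<Sum>i<N. vec_index u i * (\<Sum>j<N. affinity_mat \<sigma> N z $$ (i, j) * vec_index u j))"
    using u carrier_matD[OF affinity_mat_carrier[of \<sigma> N z]] by (simp add: scalar_prod_def atLeast0LessThan)
  also have "\<dots> = (\<Sum>i<N. \<Sum>j<N. e i j * (g i * g j))"
    unfolding sum_distrib_left
    by (intro sum.cong refl) (simp add: affinity_mat_index g_def p_def e_def mult_ac)
  also have "\<dots> \<le> (\<Sum>i<N. \<Sum>j<N. (e i j * (g i)\<^sup>2 + e i j * (g j)\<^sup>2) / 2)"
  proof (intro sum_mono)
    fix i j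
    have "e i j * (2 * g i * g j) \<le> e i j * ((g i)\<^sup>2 + (g j)\<^sup>2)"
      by (intro mult_left_mono sum_squares_bound) (simp add: e_def)
    then show "e i j * (g i * g j) \<le> (e i j * (g i)\<^sup>2 + e i j * (g j)\<^sup>2) / 2"
      by (simp add: algebra_simps)
  qed
  also have "\<dots> = ((\<Sum>i<N. \<Sum>j<N. e i j * (g i)\<^sup>2) + (\<Sum>i<N. \<Sum>j<N. e i j * (g j)\<^sup>2)) / 2"
    by (simp add: sum.distrib flip: sum_divide_distrib)
  also have "(\<Sum>i<N. \<Sum>j<N. e i j * (g j)\<^sup>2) = (\<Sum>j<N. \<Sum>i<N. e i j * (g j)\<^sup>2)"
    by (rule sum.swap)
  also have "\<dots> = (\<Sum>i<N. \<Sum>j<N. e i j * (g i)\<^sup>2)"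
    by (intro sum.cong refl) (simp add: e_sym)
  also have "(\<Sum>i<N. \<Sum>j<N. e i j * (g i)\<^sup>2) = scalar_prod u u"
    using u deg by (simp add: scalar_prod_self_eq)
  finally show ?thesis
    by simp
qed

lemma affinity_eigenvalue_le_one:
  assumes z: "\<And>i. i < N \<Longrightarrow> z i \<in> carrier_vec n"
    and v: "ordered_orthonormal_eigenbasis (affinity_mat \<sigma> N z) lam v" and i: "i < N"
  shows "lam i \<le> 1"
proof -
  have c: "v i \<in> carrier_vec N"
    by (rule eigenbasis_carrier[OF affinity_mat_carrier v i])
  have dim: "dim_row (affinity_mat \<sigma> N z) = N"
    by (rule carrier_matD(1)[OF affinity_mat_carrier])
  have one: "scalar_prod (v i) (v i) = 1" and Av: "affinity_mat \<sigma> N z *\<^sub>v v i = lam i \<cdot>\<^sub>v v i"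
    using v i dim by (auto simp: ordered_orthonormal_eigenbasis_def eigenvector_def)
  show ?thesis
    using affinity_quadratic_form_le[where z = z and \<sigma> = \<sigma>, OF z c] c by (simp add: Av one)
qed

lemma vertex_degree_le_exp:
  assumes "\<And>i j. i < N \<Longrightarrow> j < N \<Longrightarrow> scaled_sqdist \<sigma> (z i) (z j) \<le> scaled_sqdist \<sigma> (z' i) (z' j) + \<tau>"
    and "i < N"
  shows "vertex_degree \<sigma> N z' i \<le> exp \<tau> * vertex_degree \<sigma> N z i"
  unfolding vertex_degree_eq[OF assms(2)] sum_distrib_left
proof (rule sum_mono)
  fix l assume "l \<in> {..<N}"
  then show "exp (- scaled_sqdist \<sigma> (z' i) (z' l)) \<le> exp \<tau> * exp (- scaled_sqdist \<sigma> (z i) (z l))"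
    using assms(1)[of i l] assms(2) by (simp flip: exp_add)
qed

text \<open>
  The weight contributes one factor \<open>exp \<tau>\<close>, and each of the two degrees, entering with the power
  \<open>-1/2\<close>, a factor \<open>exp (\<tau> / 2)\<close>. The multiplicative form is what keeps the bound free of \<open>N\<close>.
\<close>
lemma affinity_mat_le_exp:
  assumes close: "\<And>i j. i < N \<Longrightarrow> j < N \<Longrightarrow>
      \<bar>scaled_sqdist \<sigma> (z' i) (z' j) - scaled_sqdist \<sigma> (z i) (z j)\<bar> \<le> \<tau>"
    and ij: "i < N" "j < N"
  shows "affinity_mat \<sigma> N z' $$ (i, j) \<le> exp (2 * \<tau>) * affinity_mat \<sigma> N z $$ (i, j)"
proof -
  let ?d = "vertex_degree \<sigma> N z" and ?d' = "vertex_degree \<sigma> N z'"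
  have deg: "?d' l powr (- 1 / 2) \<le> exp (\<tau> / 2) * ?d l powr (- 1 / 2)" if l: "l < N" for l
  proof -
    have pos: "0 < ?d l" "0 < ?d' l"
      using vertex_degree_ge_one[OF l, of \<sigma> z] vertex_degree_ge_one[OF l, of \<sigma> z'] by linarith+
    have "?d l \<le> exp \<tau> * ?d' l"
    proof (rule vertex_degree_le_exp[OF _ l])
      fix i j assume "i < N" "j < N"
      from close[OF this] show "scaled_sqdist \<sigma> (z' i) (z' j) \<le> scaled_sqdist \<sigma> (z i) (z j) + \<tau>"
        by linarith
    qed
    then have "exp (- \<tau>) * ?d l \<le> ?d' l"
      by (simp add: exp_minus field_simps)
    then have "?d' l powr (- 1 / 2) \<le> (exp (- \<tau>) * ?d l) powr (- 1 / 2)"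
      using pos by (intro powr_mono2') auto
    also have "\<dots> = exp (\<tau> / 2) * ?d l powr (- 1 / 2)"
      using pos by (simp add: powr_mult exp_powr_real)
    finally show ?thesis .
  qed
  have "exp (- scaled_sqdist \<sigma> (z' i) (z' j)) \<le> exp \<tau> * exp (- scaled_sqdist \<sigma> (z i) (z j))"
    using close[OF ij] by (simp flip: exp_add)
  then have "affinity_mat \<sigma> N z' $$ (i, j) \<le> (exp (\<tau> / 2) * ?d i powr (- 1 / 2))
      * (exp \<tau> * exp (- scaled_sqdist \<sigma> (z i) (z j))) * (exp (\<tau> / 2) * ?d j powr (- 1 / 2))"
    unfolding affinity_mat_index[OF ij] using deg ij by (intro mult_mono mult_nonneg_nonneg) auto
  also have "\<dots> = (exp (\<tau> / 2) * exp \<tau> * exp (\<tau> / 2)) * affinity_mat \<sigma> N z $$ (i, j)"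
    unfolding affinity_mat_index[OF ij] by simp
  also have "exp (\<tau> / 2) * exp \<tau> * exp (\<tau> / 2) = exp (2 * \<tau>)"
    by (simp flip: exp_add)
  finally show ?thesis .
qed

lemma affinity_mat_perturbation:
  assumes "0 < \<sigma>" "0 \<le> \<tau>" "\<tau> \<le> 1 / 2"
    and close: "\<And>i j. i < N \<Longrightarrow> j < N \<Longrightarrow>
      \<bar>scaled_sqdist \<sigma> (z' i) (z' j) - scaled_sqdist \<sigma> (z i) (z j)\<bar> \<le> \<tau>"
  shows "frob_norm (affinity_mat \<sigma> N z - affinity_mat \<sigma> N z') \<le> real N * (4 * \<tau>)"
proof -
  let ?A = "affinity_mat \<sigma> N z" and ?A' = "affinity_mat \<sigma> N z'"
  have "exp (2 * \<tau>) \<le> 1 + 2 * \<tau> + (2 * \<tau>)\<^sup>2"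
    using assms by (intro exp_bound) auto
  also have "(2 * \<tau>)\<^sup>2 \<le> 2 * \<tau> * 1"
    unfolding power2_eq_square using assms by (intro mult_left_mono) auto
  finally have e: "exp (2 * \<tau>) - 1 \<le> 4 * \<tau>" "0 \<le> exp (2 * \<tau>) - 1"
    using assms by auto
  have one_sided: "affinity_mat \<sigma> N y' $$ (i, j) - affinity_mat \<sigma> N y $$ (i, j) \<le> 4 * \<tau>"
    if "\<And>i j. i < N \<Longrightarrow> j < N \<Longrightarrow> \<bar>scaled_sqdist \<sigma> (y' i) (y' j) - scaled_sqdist \<sigma> (y i) (y j)\<bar> \<le> \<tau>"
      and ij: "i < N" "j < N" for y y' :: "nat \<Rightarrow> real vec" and i j
  proof -
    have "affinity_mat \<sigma> N y' $$ (i, j) - affinity_mat \<sigma> N y $$ (i, j)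
        \<le> (exp (2 * \<tau>) - 1) * affinity_mat \<sigma> N y $$ (i, j)"
      using affinity_mat_le_exp[OF that] by (simp add: left_diff_distrib)
    also have "\<dots> \<le> (exp (2 * \<tau>) - 1) * 1"
      using affinity_mat_le_one[OF assms(1) ij] e by (intro mult_left_mono) auto
    also have "\<dots> \<le> 4 * \<tau>"
      using e by simp
    finally show ?thesis .
  qed
  have entry: "\<bar>?A $$ (i, j) - ?A' $$ (i, j)\<bar> \<le> 4 * \<tau>" if "i < N" "j < N" for i j
    using one_sided[OF close that] one_sided[of z z', OF _ that] close
    by (simp add: abs_le_iff abs_minus_commute)
  have "(frob_norm (?A - ?A'))\<^sup>2 = (\<Sum>i<N. \<Sum>j<N. (?A $$ (i, j) - ?A' $$ (i, j))\<^sup>2)"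
    unfolding frob_norm_sq frob_inner_def
    by (simp add: carrier_matD[OF affinity_mat_carrier] power2_eq_square)
  also have "\<dots> \<le> (\<Sum>i<N. \<Sum>j<N. (4 * \<tau>)\<^sup>2)"
  proof (intro sum_mono)
    fix i j assume "i \<in> {..<N}" "j \<in> {..<N}"
    then have "\<bar>?A $$ (i, j) - ?A' $$ (i, j)\<bar>\<^sup>2 \<le> (4 * \<tau>)\<^sup>2"
      using entry by (intro power_mono) auto
    then show "(?A $$ (i, j) - ?A' $$ (i, j))\<^sup>2 \<le> (4 * \<tau>)\<^sup>2"
      by simp
  qed
  also have "\<dots> = (real N * (4 * \<tau>))\<^sup>2"
    by (simp add: power2_eq_square)
  finally show ?thesis
    using assms(2) by (intro power2_le_imp_le[of "frob_norm (?A - ?A')"]) auto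
qed

section \<open>Concentration of Gaussian projections\<close>

text \<open>An entry of \<open>\<Phi> a\<close>, written as a linear form in the coordinates of the sample point.\<close>
definition gaussian_form :: "(nat \<Rightarrow> real) \<Rightarrow> nat \<Rightarrow> nat \<Rightarrow> (nat \<times> nat \<Rightarrow> real) \<Rightarrow> real" where
  "gaussian_form a n r \<omega> = (\<Sum>j<n. \<omega> (r, j) * a j)"

lemma prob_space_std_normal: "prob_space std_normal_distribution"
  by (rule prob_space_normal_density) simp

lemma prob_space_gaussian_space: "prob_space (gaussian_space m n)"
  unfolding gaussian_space_def by (intro prob_space_PiM prob_space_std_normal)

lemma sets_gaussian_space [measurable_cong]:
  "sets (gaussian_space m n) = sets (PiM ({..<m} \<times> {..<n}) (\<lambda>_. borel))"
  unfolding gaussian_space_def by (intro sets_PiM_cong) auto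

lemma gaussian_entry_measurable:
  assumes "p \<in> {..<m} \<times> {..<n}"
  shows "(\<lambda>\<omega>. \<omega> p) \<in> borel_measurable (gaussian_space m n)"
  unfolding measurable_cong_sets[OF sets_gaussian_space refl]
  by (rule measurable_component_singleton[OF assms])

lemma gaussian_form_measurable:
  assumes "r < m"
  shows "gaussian_form a n r \<in> borel_measurable (gaussian_space m n)"
  unfolding gaussian_form_def [abs_def] using assms
  by (intro borel_measurable_sum borel_measurable_times gaussian_entry_measurable
      borel_measurable_const) auto

lemma gaussian_entry_distributed:
  assumes "p \<in> {..<m} \<times> {..<n}"
  shows "distributed (gaussian_space m n) lborel (\<lambda>\<omega>. \<omega> p) std_normal_density"
proof -
  have "distr (gaussian_space m n) std_normal_distribution (\<lambda>\<omega>. \<omega> p) = std_normal_distribution"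
    unfolding gaussian_space_def by (rule distr_PiM_component) (use assms prob_space_std_normal in auto)
  moreover have "distr (gaussian_space m n) std_normal_distribution (\<lambda>\<omega>. \<omega> p)
      = distr (gaussian_space m n) lborel (\<lambda>\<omega>. \<omega> p)"
    by (intro distr_cong) auto
  ultimately show ?thesis
    unfolding distributed_def using gaussian_entry_measurable[OF assms] by auto
qed

lemma gaussian_entries_indep:
  assumes "0 < m" "0 < n"
  shows "prob_space.indep_vars (gaussian_space m n) (\<lambda>_. borel) (\<lambda>p \<omega>. \<omega> p) ({..<m} \<times> {..<n})"
proof -
  interpret prob_space "gaussian_space m n" by (rule prob_space_gaussian_space)
  let ?I = "{..<m} \<times> {..<n}"
  have "distr (gaussian_space m n) (PiM ?I (\<lambda>_. borel)) (\<lambda>x. restrict x ?I)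
      = distr (gaussian_space m n) (gaussian_space m n) (\<lambda>x. x)"
    by (rule distr_cong) (simp_all add: sets_gaussian_space, auto simp: gaussian_space_def space_PiM)
  also have "\<dots> = gaussian_space m n"
    by (rule distr_id)
  also have "\<dots> = (\<Pi>\<^sub>M p\<in>?I. distr (gaussian_space m n) borel (\<lambda>\<omega>. \<omega> p))"
  proof -
    have "distr (gaussian_space m n) borel (\<lambda>\<omega>. \<omega> p) = std_normal_distribution" if "p \<in> ?I" for p
    proof -
      have "distr (gaussian_space m n) borel (\<lambda>\<omega>. \<omega> p) = distr (gaussian_space m n) lborel (\<lambda>\<omega>. \<omega> p)"
        by (intro distr_cong) auto
      with gaussian_entry_distributed[OF that] show ?thesis
        unfolding distributed_def by simp
    qed
    then show ?thesis
      unfolding gaussian_space_def[of m n] by (intro PiM_cong) auto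
  qed
  finally show ?thesis
    using assms by (subst indep_vars_iff_distr_eq_PiM') (auto intro!: gaussian_entry_measurable)
qed

lemma gaussian_forms_indep:
  assumes "0 < m" "0 < n"
  shows "prob_space.indep_vars (gaussian_space m n) (\<lambda>_. borel) (gaussian_form a n) {..<m}"
proof -
  interpret prob_space "gaussian_space m n" by (rule prob_space_gaussian_space)
  define row_index where "row_index r = {r} \<times> {..<n}" for r :: nat
  have "indep_vars (\<lambda>r. PiM (row_index r) (\<lambda>_. borel)) (\<lambda>r \<omega>. restrict (\<lambda>p. \<omega> p) (row_index r)) {..<m}"
    by (rule indep_vars_restrict[OF gaussian_entries_indep[OF assms]])
       (auto simp: row_index_def disjoint_family_on_def)
  then have "indep_vars (\<lambda>_. borel)
      (\<lambda>r \<omega>. (\<Sum>j<n. restrict (\<lambda>p. \<omega> p) (row_index r) (r, j) * a j)) {..<m}"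
  proof (rule indep_vars_compose2)
    fix r assume "r \<in> {..<m}"
    show "(\<lambda>\<psi>. \<Sum>j<n. \<psi> (r, j) * a j) \<in> borel_measurable (PiM (row_index r) (\<lambda>_. borel))"
      by (intro borel_measurable_sum borel_measurable_times borel_measurable_const
          measurable_component_singleton) (auto simp: row_index_def)
  qed
  also have "(\<lambda>r \<omega>. (\<Sum>j<n. restrict (\<lambda>p. \<omega> p) (row_index r) (r, j) * a j)) = gaussian_form a n"
    by (auto simp: gaussian_form_def row_index_def fun_eq_iff intro!: sum.cong)
  finally show ?thesis .
qed

lemma gaussian_form_distributed:
  assumes "r < m" "0 < (\<Sum>j<n. (a j)\<^sup>2)"
  shows "distributed (gaussian_space m n) lborel (gaussian_form a n r)
           (normal_density 0 (sqrt (\<Sum>j<n. (a j)\<^sup>2)))"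
proof -
  interpret prob_space "gaussian_space m n" by (rule prob_space_gaussian_space)
  define J where "J = {j. j < n \<and> a j \<noteq> 0}"
  have "\<exists>j<n. a j \<noteq> 0"
  proof (rule ccontr)
    assume "\<not> (\<exists>j<n. a j \<noteq> 0)"
    then have "(\<Sum>j<n. (a j)\<^sup>2) = 0"
      by simp
    with assms(2) show False
      by simp
  qed
  then have J: "J \<noteq> {}" "finite J"
    by (auto simp: J_def)
  have nm: "0 < m" "0 < n"
    using assms(1) J by (auto simp: J_def)
  let ?I = "{r} \<times> J"
  have sub: "?I \<subseteq> {..<m} \<times> {..<n}"
    using assms(1) by (auto simp: J_def)
  have "indep_vars (\<lambda>_. borel) (\<lambda>p \<omega>. \<omega> p) ?I"
    by (rule indep_vars_subset[OF gaussian_entries_indep[OF nm] sub])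
  then have ind: "indep_vars (\<lambda>_. borel) (\<lambda>p \<omega>. \<omega> p * a (snd p)) ?I"
    by (rule indep_vars_compose2) auto
  have "distributed (gaussian_space m n) lborel (\<lambda>\<omega>. \<Sum>p\<in>?I. \<omega> p * a (snd p))
      (normal_density (\<Sum>p\<in>?I. 0) (sqrt (\<Sum>p\<in>?I. \<bar>a (snd p)\<bar>\<^sup>2)))"
  proof (rule sum_indep_normal[OF _ _ ind])
    fix p assume p: "p \<in> ?I"
    then show "0 < \<bar>a (snd p)\<bar>"
      by (auto simp: J_def)
    show "distributed (gaussian_space m n) lborel (\<lambda>\<omega>. \<omega> p * a (snd p)) (normal_density 0 \<bar>a (snd p)\<bar>)"
      using normal_density_affine[OF gaussian_entry_distributed[of p m n], where \<alpha> = "a (snd p)" and \<beta> = 0] p sub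
      by (auto simp: J_def mult.commute)
  qed (use J in auto)
  also have "(\<lambda>\<omega>. \<Sum>p\<in>?I. \<omega> p * a (snd p)) = gaussian_form a n r"
  proof
    fix \<omega> :: "nat \<times> nat \<Rightarrow> real"
    have "(\<Sum>p\<in>?I. \<omega> p * a (snd p)) = (\<Sum>j\<in>J. \<omega> (r, j) * a j)"
      by (rule sum.reindex_bij_witness[of _ "\<lambda>j. (r, j)" snd]) auto
    also have "\<dots> = gaussian_form a n r \<omega>"
      unfolding gaussian_form_def by (rule sum.mono_neutral_left) (auto simp: J_def)
    finally show "(\<Sum>p\<in>?I. \<omega> p * a (snd p)) = gaussian_form a n r \<omega>" .
  qed
  also have "(\<Sum>p\<in>?I. \<bar>a (snd p)\<bar>\<^sup>2) = (\<Sum>j\<in>J. (a j)\<^sup>2)"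
    by (rule sum.reindex_bij_witness[of _ "\<lambda>j. (r, j)" snd]) auto
  also have "\<dots> = (\<Sum>j<n. (a j)\<^sup>2)"
    by (rule sum.mono_neutral_left) (auto simp: J_def)
  finally show ?thesis
    by simp
qed

text \<open>
  The factor \<open>exp (t (x / \<sigma>)\<^sup>2)\<close> turns the normal density into a multiple of another one, whose
  standard deviation is \<open>\<sigma> / sqrt (1 - 2 t)\<close>.
\<close>
lemma nn_integral_exp_square_normal:
  assumes "0 < \<sigma>" "t < 1 / 2"
  shows "(\<integral>\<^sup>+x. ennreal (normal_density 0 \<sigma> x) * ennreal (exp (t * (x / \<sigma>)\<^sup>2)) \<partial>lborel)
           = ennreal (1 / sqrt (1 - 2 * t))"
proof -
  define \<tau> where "\<tau> = \<sigma> / sqrt (1 - 2 * t)"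
  have pos: "0 < 1 - 2 * t" "0 < \<tau>"
    using assms by (auto simp: \<tau>_def)
  have "normal_density 0 \<sigma> x * exp (t * (x / \<sigma>)\<^sup>2) = 1 / sqrt (1 - 2 * t) * normal_density 0 \<tau> x" for x
  proof -
    have \<tau>2: "\<tau>\<^sup>2 = \<sigma>\<^sup>2 / (1 - 2 * t)"
      using pos by (simp add: \<tau>_def power_divide)
    have "- x\<^sup>2 / (2 * \<sigma>\<^sup>2) + t * (x / \<sigma>)\<^sup>2 = - x\<^sup>2 / (2 * \<tau>\<^sup>2)"
      unfolding \<tau>2 using pos assms by (simp add: field_simps power2_eq_square)
    then have e: "exp (- x\<^sup>2 / (2 * \<sigma>\<^sup>2)) * exp (t * (x / \<sigma>)\<^sup>2) = exp (- x\<^sup>2 / (2 * \<tau>\<^sup>2))"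
      by (simp flip: exp_add)
    have s: "sqrt (2 * pi * \<tau>\<^sup>2) = sqrt (2 * pi * \<sigma>\<^sup>2) / sqrt (1 - 2 * t)"
      unfolding \<tau>2 times_divide_eq_right real_sqrt_divide ..
    have "normal_density 0 \<sigma> x * exp (t * (x / \<sigma>)\<^sup>2)
        = 1 / sqrt (2 * pi * \<sigma>\<^sup>2) * (exp (- x\<^sup>2 / (2 * \<sigma>\<^sup>2)) * exp (t * (x / \<sigma>)\<^sup>2))"
      unfolding normal_density_def by simp
    also have "\<dots> = 1 / sqrt (1 - 2 * t) * normal_density 0 \<tau> x"
      unfolding e normal_density_def s using pos by simp
    finally show ?thesis .
  qed
  then have "(\<integral>\<^sup>+x. ennreal (normal_density 0 \<sigma> x) * ennreal (exp (t * (x / \<sigma>)\<^sup>2)) \<partial>lborel)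
      = (\<integral>\<^sup>+x. ennreal (1 / sqrt (1 - 2 * t)) * ennreal (normal_density 0 \<tau> x) \<partial>lborel)"
    using pos by (intro nn_integral_cong) (simp flip: ennreal_mult' ennreal_mult'')
  also have "\<dots> = ennreal (1 / sqrt (1 - 2 * t)) * (\<integral>\<^sup>+x. ennreal (normal_density 0 \<tau> x) \<partial>lborel)"
    by (rule nn_integral_cmult) auto
  also have "(\<integral>\<^sup>+x. ennreal (normal_density 0 \<tau> x) \<partial>lborel) = 1"
    using pos by (simp add: nn_integral_eq_integral)
  finally show ?thesis
    by simp
qed

text \<open>
  Normalised to be a sum of \<open>m\<close> squares of independent standard normal variables, a chi-square
  variable, whatever the coefficients \<open>a\<close> are (not all zero).
\<close>
definition energy_ratio :: "(nat \<Rightarrow> real) \<Rightarrow> nat \<Rightarrow> nat \<Rightarrow> (nat \<times> nat \<Rightarrow> real) \<Rightarrow> real" where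
  "energy_ratio a m n \<omega> = (\<Sum>r<m. (gaussian_form a n r \<omega>)\<^sup>2) / (\<Sum>j<n. (a j)\<^sup>2)"

lemma energy_ratio_measurable [measurable]:
  "energy_ratio a m n \<in> borel_measurable (gaussian_space m n)"
  unfolding energy_ratio_def [abs_def]
  by (intro borel_measurable_divide borel_measurable_sum borel_measurable_power
      gaussian_form_measurable borel_measurable_const) auto

lemma energy_ratio_mgf:
  assumes "0 < (\<Sum>j<n. (a j)\<^sup>2)" "0 < m" "t < 1 / 2"
  shows "(\<integral>\<^sup>+\<omega>. ennreal (exp (t * energy_ratio a m n \<omega>)) \<partial>gaussian_space m n)
           = ennreal ((1 / sqrt (1 - 2 * t)) ^ m)"
proof -
  interpret prob_space "gaussian_space m n" by (rule prob_space_gaussian_space)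
  have n: "0 < n"
    using assms(1) by (cases n) auto
  define \<sigma> where "\<sigma> = sqrt (\<Sum>j<n. (a j)\<^sup>2)"
  have \<sigma>: "0 < \<sigma>" and \<sigma>2: "\<sigma>\<^sup>2 = (\<Sum>j<n. (a j)\<^sup>2)"
    using assms(1) by (auto simp: \<sigma>_def)
  have "energy_ratio a m n \<omega> = (\<Sum>r<m. (gaussian_form a n r \<omega> / \<sigma>)\<^sup>2)" for \<omega>
    unfolding energy_ratio_def \<sigma>2[symmetric] by (simp add: power_divide sum_divide_distrib)
  then have "(\<integral>\<^sup>+\<omega>. ennreal (exp (t * energy_ratio a m n \<omega>)) \<partial>gaussian_space m n)
      = (\<integral>\<^sup>+\<omega>. (\<Prod>r<m. ennreal (exp (t * (gaussian_form a n r \<omega> / \<sigma>)\<^sup>2))) \<partial>gaussian_space m n)"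
    by (simp add: sum_distrib_left exp_sum prod_ennreal)
  also have "\<dots> = (\<Prod>r<m. \<integral>\<^sup>+\<omega>. ennreal (exp (t * (gaussian_form a n r \<omega> / \<sigma>)\<^sup>2)) \<partial>gaussian_space m n)"
    by (intro indep_vars_nn_integral indep_vars_compose2[OF gaussian_forms_indep[OF assms(2) n]]) auto
  also have "\<dots> = (\<Prod>r<m. ennreal (1 / sqrt (1 - 2 * t)))"
  proof (rule prod.cong)
    fix r assume "r \<in> {..<m}"
    then have d: "distributed (gaussian_space m n) lborel (gaussian_form a n r) (normal_density 0 \<sigma>)"
      unfolding \<sigma>_def using gaussian_form_distributed assms(1) by auto
    show "(\<integral>\<^sup>+\<omega>. ennreal (exp (t * (gaussian_form a n r \<omega> / \<sigma>)\<^sup>2)) \<partial>gaussian_space m n)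
        = ennreal (1 / sqrt (1 - 2 * t))"
      using distributed_nn_integral[OF d, of "\<lambda>x. ennreal (exp (t * (x / \<sigma>)\<^sup>2))"]
        nn_integral_exp_square_normal[OF \<sigma> assms(3)] by simp
  qed simp
  also have "\<dots> = ennreal ((1 / sqrt (1 - 2 * t)) ^ m)"
    using assms(3) by (simp add: ennreal_power)
  finally show ?thesis .
qed

lemma inverse_sqrt_power_eq_exp:
  assumes "0 < (y::real)"
  shows "(1 / sqrt y) ^ m = exp (- real m * ln y / 2)"
proof -
  have "1 / sqrt y = exp (- ln y / 2)"
    using assms by (simp add: exp_minus inverse_eq_divide ln_sqrt[symmetric] flip: exp_ln)
  then show ?thesis
    by (simp flip: exp_of_nat_mult)
qed

text \<open>
  Chernoff's bound with the exponent \<open>t = \<delta> / 8\<close>, which is close enough to the optimal choice for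
  the two-term estimate of the logarithm to give a multiple of \<open>\<delta>\<^sup>2\<close>; likewise for the lower tail.
\<close>
lemma energy_ratio_upper_tail:
  assumes "0 < (\<Sum>j<n. (a j)\<^sup>2)" "0 < m" "0 < \<delta>" "\<delta> \<le> 1"
  shows "measure (gaussian_space m n)
           {\<omega> \<in> space (gaussian_space m n). energy_ratio a m n \<omega> \<ge> m * (1 + \<delta>)}
           \<le> exp (- (m * \<delta>\<^sup>2 / 16))"
proof -
  interpret prob_space "gaussian_space m n" by (rule prob_space_gaussian_space)
  have sq: "(2 * (\<delta> / 8))\<^sup>2 = \<delta>\<^sup>2 / 16"
    by (simp add: power2_eq_square)
  have "- (2 * (\<delta> / 8)) - 2 * (2 * (\<delta> / 8))\<^sup>2 \<le> ln (1 - 2 * (\<delta> / 8))"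
    using ln_one_minus_pos_lower_bound[of "2 * (\<delta> / 8)"] assms by simp
  moreover have "- (\<delta> / 8) * (1 + \<delta>) = - (\<delta> / 8) - \<delta>\<^sup>2 / 8"
    by (simp add: power2_eq_square algebra_simps)
  ultimately have l: "- (\<delta> / 8) * (1 + \<delta>) - ln (1 - 2 * (\<delta> / 8)) / 2 \<le> - (\<delta>\<^sup>2 / 16)"
    unfolding sq by linarith
  have "emeasure (gaussian_space m n)
          {\<omega> \<in> space (gaussian_space m n). energy_ratio a m n \<omega> \<ge> m * (1 + \<delta>)}
      \<le> ennreal (exp (- (\<delta> / 8) * (m * (1 + \<delta>)))) * ennreal ((1 / sqrt (1 - 2 * (\<delta> / 8))) ^ m)"
    using Chernoff_ineq_nn_integral_ge[of "\<delta> / 8" "space (gaussian_space m n)" "gaussian_space m n"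
        "energy_ratio a m n" "m * (1 + \<delta>)"] energy_ratio_mgf[of a n m "\<delta> / 8"] assms
    by (auto cong: nn_integral_cong)
  also have "\<dots> = ennreal (exp (real m * (- (\<delta> / 8) * (1 + \<delta>) - ln (1 - 2 * (\<delta> / 8)) / 2)))"
  proof -
    have "- (\<delta> / 8) * (m * (1 + \<delta>)) + - real m * ln (1 - 2 * (\<delta> / 8)) / 2
        = real m * (- (\<delta> / 8) * (1 + \<delta>) - ln (1 - 2 * (\<delta> / 8)) / 2)"
      by (simp add: right_diff_distrib mult.left_commute mult.commute[of _ "real m"])
    moreover have "(1 / sqrt (1 - 2 * (\<delta> / 8))) ^ m = exp (- real m * ln (1 - 2 * (\<delta> / 8)) / 2)"
      using assms by (intro inverse_sqrt_power_eq_exp) simp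
    ultimately show ?thesis
      by (simp only: ennreal_mult'[symmetric] exp_ge_zero exp_add[symmetric])
  qed
  also have "\<dots> \<le> ennreal (exp (real m * (- (\<delta>\<^sup>2 / 16))))"
    using mult_left_mono[OF l, of "real m"] by (intro ennreal_leI) (simp only: exp_le_cancel_iff of_nat_0_le_iff)
  finally show ?thesis
    by (simp add: emeasure_eq_measure)
qed

lemma energy_ratio_lower_tail:
  assumes "0 < (\<Sum>j<n. (a j)\<^sup>2)" "0 < m" "0 < \<delta>" "\<delta> \<le> 1"
  shows "measure (gaussian_space m n)
           {\<omega> \<in> space (gaussian_space m n). energy_ratio a m n \<omega> \<le> m * (1 - \<delta>)}
           \<le> exp (- (m * \<delta>\<^sup>2 / 16))"
proof -
  interpret prob_space "gaussian_space m n" by (rule prob_space_gaussian_space)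
  have sq: "(2 * (\<delta> / 8))\<^sup>2 = \<delta>\<^sup>2 / 16"
    by (simp add: power2_eq_square)
  have "2 * (\<delta> / 8) - (2 * (\<delta> / 8))\<^sup>2 \<le> ln (1 + 2 * (\<delta> / 8))"
    using ln_one_plus_pos_lower_bound[of "2 * (\<delta> / 8)"] assms by simp
  moreover have "\<delta> / 8 * (1 - \<delta>) = \<delta> / 8 - \<delta>\<^sup>2 / 8"
    by (simp add: power2_eq_square field_simps)
  moreover have "0 \<le> \<delta>\<^sup>2"
    by simp
  ultimately have l: "\<delta> / 8 * (1 - \<delta>) - ln (1 + 2 * (\<delta> / 8)) / 2 \<le> - (\<delta>\<^sup>2 / 16)"
    unfolding sq by linarith
  have "emeasure (gaussian_space m n)
          {\<omega> \<in> space (gaussian_space m n). energy_ratio a m n \<omega> \<le> m * (1 - \<delta>)}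
      \<le> ennreal (exp (\<delta> / 8 * (m * (1 - \<delta>)))) * ennreal ((1 / sqrt (1 + 2 * (\<delta> / 8))) ^ m)"
    using Chernoff_ineq_nn_integral_le[of "\<delta> / 8" "space (gaussian_space m n)" "gaussian_space m n"
        "energy_ratio a m n" "m * (1 - \<delta>)"] energy_ratio_mgf[of a n m "- (\<delta> / 8)"] assms
    by (auto cong: nn_integral_cong)
  also have "\<dots> = ennreal (exp (real m * (\<delta> / 8 * (1 - \<delta>) - ln (1 + 2 * (\<delta> / 8)) / 2)))"
  proof -
    have "\<delta> / 8 * (m * (1 - \<delta>)) + - real m * ln (1 + 2 * (\<delta> / 8)) / 2
        = real m * (\<delta> / 8 * (1 - \<delta>) - ln (1 + 2 * (\<delta> / 8)) / 2)"
      by (simp add: right_diff_distrib mult.left_commute mult.commute[of _ "real m"])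
    moreover have "(1 / sqrt (1 + 2 * (\<delta> / 8))) ^ m = exp (- real m * ln (1 + 2 * (\<delta> / 8)) / 2)"
      using assms by (intro inverse_sqrt_power_eq_exp) simp
    ultimately show ?thesis
      by (simp only: ennreal_mult'[symmetric] exp_ge_zero exp_add[symmetric])
  qed
  also have "\<dots> \<le> ennreal (exp (real m * (- (\<delta>\<^sup>2 / 16))))"
    using mult_left_mono[OF l, of "real m"] by (intro ennreal_leI) (simp only: exp_le_cancel_iff of_nat_0_le_iff)
  finally show ?thesis
    by (simp add: emeasure_eq_measure)
qed

lemma johnson_lindenstrauss_event:
  assumes "finite P" "\<And>a. a \<in> P \<Longrightarrow> 0 < (\<Sum>j<n. (a j)\<^sup>2)" "0 < m" "0 < \<delta>" "\<delta> \<le> 1"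
  shows "\<exists>E \<in> sets (gaussian_space m n).
    measure (gaussian_space m n) E \<ge> 1 - 2 * real (card P) * exp (- (m * \<delta>\<^sup>2 / 16)) \<and>
    (\<forall>\<omega>\<in>E. \<forall>a\<in>P. \<bar>energy_ratio a m n \<omega> - m\<bar> \<le> m * \<delta>)"
proof -
  interpret prob_space "gaussian_space m n" by (rule prob_space_gaussian_space)
  let ?M = "gaussian_space m n" and ?x = "exp (- (m * \<delta>\<^sup>2 / 16))"
  define bad where "bad a = {\<omega> \<in> space ?M. energy_ratio a m n \<omega> \<ge> m * (1 + \<delta>)}
      \<union> {\<omega> \<in> space ?M. energy_ratio a m n \<omega> \<le> m * (1 - \<delta>)}" for a
  have bad [measurable]: "bad a \<in> sets ?M" for a
    unfolding bad_def by measurable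
  have "prob (bad a) \<le> 2 * ?x" if "a \<in> P" for a
  proof -
    have "prob (bad a) \<le> prob {\<omega> \<in> space ?M. energy_ratio a m n \<omega> \<ge> m * (1 + \<delta>)}
        + prob {\<omega> \<in> space ?M. energy_ratio a m n \<omega> \<le> m * (1 - \<delta>)}"
      unfolding bad_def by (intro measure_Un_le) measurable
    then show ?thesis
      using energy_ratio_upper_tail[of a n m \<delta>] energy_ratio_lower_tail[of a n m \<delta>] assms that by auto
  qed
  then have "(\<Sum>a\<in>P. prob (bad a)) \<le> (\<Sum>a\<in>P. 2 * ?x)"
    by (rule sum_mono)
  moreover have "prob (\<Union>a\<in>P. bad a) \<le> (\<Sum>a\<in>P. prob (bad a))"
    using assms(1) by (intro finite_measure_subadditive_finite) auto
  ultimately have "prob (\<Union>a\<in>P. bad a) \<le> 2 * real (card P) * ?x"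
    by simp
  moreover have U: "(\<Union>a\<in>P. bad a) \<in> sets ?M"
    using assms(1) by auto
  ultimately have "prob (space ?M - (\<Union>a\<in>P. bad a)) \<ge> 1 - 2 * real (card P) * ?x"
    by (simp add: prob_compl)
  moreover have "\<bar>energy_ratio a m n \<omega> - m\<bar> \<le> m * \<delta>"
    if "\<omega> \<in> space ?M - (\<Union>a\<in>P. bad a)" "a \<in> P" for \<omega> a
  proof -
    have "\<omega> \<notin> bad a" "\<omega> \<in> space ?M"
      using that by auto
    then show ?thesis
      by (auto simp: bad_def abs_le_iff algebra_simps)
  qed
  ultimately show ?thesis
    using U by (intro bexI[of _ "space ?M - (\<Union>a\<in>P. bad a)"]) auto
qed

lemma compressed_scaled_sqdist:
  assumes x: "x \<in> carrier_vec n" "y \<in> carrier_vec n"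
    and pos: "0 < (\<Sum>j<n. (vec_index x j - vec_index y j)\<^sup>2)" and m: "0 < m"
  shows "scaled_sqdist \<sigma> (compressed m (gaussian_mat m n \<omega>) x) (compressed m (gaussian_mat m n \<omega>) y)
    = energy_ratio (\<lambda>j. vec_index x j - vec_index y j) m n \<omega> / m * scaled_sqdist \<sigma> x y"
proof -
  let ?a = "\<lambda>j. vec_index x j - vec_index y j" and ?C = "compressed m (gaussian_mat m n \<omega>)"
  have xy: "scalar_prod (x - y) (x - y) = (\<Sum>j<n. (?a j)\<^sup>2)"
    unfolding scalar_prod_self_eq using x by simp
  have entry: "vec_index (?C x - ?C y) r = 1 / sqrt m * gaussian_form ?a n r \<omega>" if "r < m" for r
    using x that
    by (simp add: compressed_def gaussian_mat_def scalar_prod_def atLeast0LessThan gaussian_form_def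
        right_diff_distrib sum_subtractf diff_divide_distrib)
  have "dim_vec (?C x - ?C y) = m"
    by (simp add: compressed_def gaussian_mat_def)
  then have "scalar_prod (?C x - ?C y) (?C x - ?C y) = (\<Sum>r<m. (1 / sqrt m * gaussian_form ?a n r \<omega>)\<^sup>2)"
    unfolding scalar_prod_self_eq using entry by simp
  also have "\<dots> = (\<Sum>r<m. (gaussian_form ?a n r \<omega>)\<^sup>2) / m"
    using m by (simp add: power_divide sum_divide_distrib)
  also have "\<dots> = energy_ratio ?a m n \<omega> / m * scalar_prod (x - y) (x - y)"
    unfolding energy_ratio_def xy using pos by simp
  finally show ?thesis
    unfolding scaled_sqdist_def vnorm_sq by simp
qed

text \<open>Coinciding points have no energy ratio; their distance is preserved trivially.\<close>
lemma sqdist_zero_imp_eq: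
  fixes x y :: "real vec"
  assumes "x \<in> carrier_vec n" "y \<in> carrier_vec n" "\<not> 0 < (\<Sum>j<n. (vec_index x j - vec_index y j)\<^sup>2)"
  shows "x = y"
proof -
  have "(\<Sum>j<n. (vec_index x j - vec_index y j)\<^sup>2) = 0"
    using assms(3) sum_nonneg[of "{..<n}" "\<lambda>j. (vec_index x j - vec_index y j)\<^sup>2"] by force
  then show ?thesis
    using assms(1,2) by (intro eq_vecI) (auto simp: sum_nonneg_eq_0_iff)
qed

lemma compressed_distances_event:
  assumes x: "\<And>i. i < N \<Longrightarrow> x i \<in> carrier_vec n" and \<sigma>: "0 < \<sigma>" and m: "0 < m" and \<delta>: "0 < \<delta>" "\<delta> \<le> 1"
  shows "\<exists>E \<in> sets (gaussian_space m n).
    measure (gaussian_space m n) E \<ge> 1 - 2 * (real N)\<^sup>2 * exp (- (m * \<delta>\<^sup>2 / 16)) \<and>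
    (\<forall>\<omega>\<in>E. \<forall>i<N. \<forall>j<N.
      \<bar>scaled_sqdist \<sigma> (compressed m (gaussian_mat m n \<omega>) (x i)) (compressed m (gaussian_mat m n \<omega>) (x j))
        - scaled_sqdist \<sigma> (x i) (x j)\<bar> \<le> \<delta> * scaled_sqdist \<sigma> (x i) (x j))"
proof -
  define diff where "diff p = (\<lambda>l. vec_index (x (fst p)) l - vec_index (x (snd p)) l)" for p
  define P where "P = {a \<in> diff ` ({..<N} \<times> {..<N}). 0 < (\<Sum>j<n. (a j)\<^sup>2)}"
  have "card P \<le> card (diff ` ({..<N} \<times> {..<N}))"
    unfolding P_def by (intro card_mono) auto
  also have "\<dots> \<le> card ({..<N} \<times> {..<N})"
    by (intro card_image_le) auto
  finally have "card P \<le> N * N"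
    by simp
  then have card: "real (card P) \<le> (real N)\<^sup>2"
    unfolding power2_eq_square of_nat_mult[symmetric] of_nat_le_iff .
  have "finite P"
    unfolding P_def by simp
  then have "\<exists>E \<in> sets (gaussian_space m n).
      measure (gaussian_space m n) E \<ge> 1 - 2 * real (card P) * exp (- (m * \<delta>\<^sup>2 / 16)) \<and>
      (\<forall>\<omega>\<in>E. \<forall>a\<in>P. \<bar>energy_ratio a m n \<omega> - m\<bar> \<le> m * \<delta>)"
    by (rule johnson_lindenstrauss_event[OF _ _ m \<delta>]) (simp add: P_def)
  then obtain E where E: "E \<in> sets (gaussian_space m n)"
      "measure (gaussian_space m n) E \<ge> 1 - 2 * real (card P) * exp (- (m * \<delta>\<^sup>2 / 16))"
      "\<And>\<omega> a. \<omega> \<in> E \<Longrightarrow> a \<in> P \<Longrightarrow> \<bar>energy_ratio a m n \<omega> - m\<bar> \<le> m * \<delta>"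
    by blast
  have "2 * real (card P) * exp (- (m * \<delta>\<^sup>2 / 16)) \<le> 2 * (real N)\<^sup>2 * exp (- (m * \<delta>\<^sup>2 / 16))"
    using card by (intro mult_right_mono) auto
  then have prob: "measure (gaussian_space m n) E \<ge> 1 - 2 * (real N)\<^sup>2 * exp (- (m * \<delta>\<^sup>2 / 16))"
    using E(2) by linarith
  have "\<bar>scaled_sqdist \<sigma> (compressed m (gaussian_mat m n \<omega>) (x i)) (compressed m (gaussian_mat m n \<omega>) (x j))
        - scaled_sqdist \<sigma> (x i) (x j)\<bar> \<le> \<delta> * scaled_sqdist \<sigma> (x i) (x j)"
    if \<omega>: "\<omega> \<in> E" and ij: "i < N" "j < N" for \<omega> i j
  proof (cases "0 < (\<Sum>l<n. (vec_index (x i) l - vec_index (x j) l)\<^sup>2)")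
    case True
    let ?q = "scaled_sqdist \<sigma> (x i) (x j)" and ?e = "energy_ratio (diff (i, j)) m n \<omega>"
    have "diff (i, j) \<in> P"
      unfolding P_def using ij True by (auto simp: diff_def intro!: image_eqI[of _ _ "(i, j)"])
    from E(3)[OF \<omega> this] have "\<bar>?e - m\<bar> / m \<le> \<delta>"
      using m by (subst pos_divide_le_eq) (simp_all only: mult.commute of_nat_0_less_iff)
    then have "\<bar>?e - m\<bar> / m * ?q \<le> \<delta> * ?q"
      by (intro mult_right_mono scaled_sqdist_nonneg \<sigma>)
    moreover have "\<bar>?e / m * ?q - ?q\<bar> = \<bar>?e - m\<bar> / m * ?q"
    proof -
      have "?e / m * ?q - ?q = (?e - m) / m * ?q"
        using m by (simp add: field_simps)
      then show ?thesis
        using scaled_sqdist_nonneg[OF \<sigma>, of "x i" "x j"] by (simp add: abs_mult)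
    qed
    ultimately show ?thesis
      using compressed_scaled_sqdist[OF x[OF ij(1)] x[OF ij(2)] True m, of \<sigma> \<omega>] by (simp add: diff_def)
  next
    case False
    then have "x i = x j"
      using x ij by (intro sqdist_zero_imp_eq[of _ n]) auto
    then show ?thesis
      by simp
  qed
  then show ?thesis
    using E(1) prob by blast
qed

section \<open>Entrywise perturbation of the eigenvectors\<close>

lemma scaled_sqdist_le_max:
  assumes "i < N" "j < N"
  shows "scaled_sqdist \<sigma> (x i) (x j) \<le> max_scaled_sqdist \<sigma> N x"
  unfolding max_scaled_sqdist_def
proof (rule Max_ge)
  show "scaled_sqdist \<sigma> (x i) (x j) \<in> (\<lambda>(i, j). scaled_sqdist \<sigma> (x i) (x j)) ` ({..<N} \<times> {..<N})"
    by (rule image_eqI[of _ _ "(i, j)"]) (use assms in auto)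
qed simp

text \<open>
  The number of pairs is at most \<open>1 / \<epsilon>\<^sup>2 = exp L\<close>, and \<open>m\<close> makes the exponent of the tail bound
  at least \<open>(1 + ln (2 / \<eta>)) L\<close> with \<open>L = ln (1 / \<epsilon>\<^sup>2)\<close>, because \<open>n / (\<epsilon>\<^sup>2 s) \<ge> 1 / \<epsilon>\<^sup>2\<close>. The
  constant 256 is \<open>4\<^sup>2 \<cdot> 16\<close>, from the choice of \<open>\<delta>\<close> and from the tail bound.
\<close>
lemma failure_probability_le:
  fixes \<eta> B \<epsilon> :: real
  assumes \<eta>: "0 < \<eta>" "\<eta> < 1" and \<epsilon>: "0 < \<epsilon>" "\<epsilon> < 1 / 2" and N: "real N * \<epsilon> < 1" and s: "1 \<le> s" "s \<le> n"
    and m: "real m \<ge> 256 * (\<bar>B\<bar> + 1)\<^sup>2 * (1 + ln (2 / \<eta>)) * (real s / \<epsilon>\<^sup>2) * ln (real n / (\<epsilon>\<^sup>2 * real s))"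
  shows "0 < m" and "2 * (real N)\<^sup>2 * exp (- (m * (\<epsilon> / (4 * (\<bar>B\<bar> + 1)))\<^sup>2 / 16)) \<le> \<eta>"
proof -
  define L where "L = ln (1 / \<epsilon>\<^sup>2)"
  define l where "l = ln (2 / \<eta>)"
  define C where "C = 256 * (\<bar>B\<bar> + 1)\<^sup>2"
  have l: "0 < l"
    using \<eta> by (simp add: l_def)
  have C: "0 < C"
    by (simp add: C_def add_nonneg_pos)
  \<comment> \<open>Since \<open>\<epsilon>\<close> is bounded away from 1, the logarithm \<open>L\<close> is at least 1, so that the multiple
    \<open>l = ln (2 / \<eta>)\<close> of it pays for the confidence level and one further \<open>L\<close> for the \<open>N\<^sup>2\<close> pairs.\<close>
  have "\<epsilon>\<^sup>2 \<le> (1 / 2)\<^sup>2"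
    using \<epsilon> by (intro power_mono) auto
  then have "4 \<le> 1 / \<epsilon>\<^sup>2"
    using \<epsilon> by (simp add: field_simps power2_eq_square)
  then have "ln 4 \<le> L"
    unfolding L_def using \<epsilon> by (intro iffD2[OF ln_le_cancel_iff]) auto
  moreover have "1 \<le> ln (4 :: real)"
    using exp_le by (subst ln_ge_iff) auto
  ultimately have L: "1 \<le> L"
    by linarith
  have "1 / \<epsilon>\<^sup>2 \<le> real n / (\<epsilon>\<^sup>2 * real s)"
    using s \<epsilon> by (simp add: field_simps)
  then have "L \<le> ln (real n / (\<epsilon>\<^sup>2 * real s))"
    unfolding L_def using \<epsilon> s by (intro iffD2[OF ln_le_cancel_iff]) auto
  moreover have "1 / \<epsilon>\<^sup>2 \<le> real s / \<epsilon>\<^sup>2"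
    using s by (intro divide_right_mono) auto
  ultimately have "1 / \<epsilon>\<^sup>2 * L \<le> real s / \<epsilon>\<^sup>2 * ln (real n / (\<epsilon>\<^sup>2 * real s))"
    using L by (intro mult_mono) auto
  then have "C * (1 + l) * (1 / \<epsilon>\<^sup>2 * L) \<le> C * (1 + l) * (real s / \<epsilon>\<^sup>2 * ln (real n / (\<epsilon>\<^sup>2 * real s)))"
    using C l by (intro mult_left_mono) auto
  also have "\<dots> \<le> m"
    using m by (simp add: C_def l_def mult.assoc)
  finally have mge: "C * (1 + l) * (1 / \<epsilon>\<^sup>2 * L) \<le> m" .
  have "0 < C * (1 + l) * (1 / \<epsilon>\<^sup>2 * L)"
    using C l L \<epsilon> by (intro mult_pos_pos) auto
  with mge show "0 < m"
    by (metis less_le_trans of_nat_0_less_iff)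
  have "(1 + l) * L = C * (1 + l) * (1 / \<epsilon>\<^sup>2 * L) * (\<epsilon>\<^sup>2 / C)"
    using C \<epsilon> by simp
  also have "\<dots> \<le> m * (\<epsilon>\<^sup>2 / C)"
    using mge C by (intro mult_right_mono) auto
  also have "\<dots> = m * (\<epsilon> / (4 * (\<bar>B\<bar> + 1)))\<^sup>2 / 16"
    by (simp add: C_def power_divide power_mult_distrib del: distrib_left_numeral)
  finally have expo: "(1 + l) * L \<le> m * (\<epsilon> / (4 * (\<bar>B\<bar> + 1)))\<^sup>2 / 16" .
  have "(real N * \<epsilon>)\<^sup>2 \<le> 1\<^sup>2"
    using N \<epsilon> by (intro power_mono) auto
  then have "(real N)\<^sup>2 \<le> 1 / \<epsilon>\<^sup>2"
    using \<epsilon> by (simp add: field_simps power_mult_distrib)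
  also have "1 / \<epsilon>\<^sup>2 = exp L"
    unfolding L_def using \<epsilon> by (intro exp_ln[symmetric]) simp
  finally have "2 * (real N)\<^sup>2 * exp (- (m * (\<epsilon> / (4 * (\<bar>B\<bar> + 1)))\<^sup>2 / 16)) \<le> 2 * exp L * exp (- ((1 + l) * L))"
    using expo by (intro mult_mono) auto
  also have "\<dots> = 2 * exp (- (l * L))"
  proof -
    have "exp L * exp (- ((1 + l) * L)) = exp (L + - ((1 + l) * L))"
      by (rule exp_add[symmetric])
    also have "L + - ((1 + l) * L) = - (l * L)"
      by (simp add: distrib_right)
    finally show ?thesis
      by (simp only: mult.assoc)
  qed
  also have "\<dots> \<le> 2 * exp (- l)"
    using mult_left_mono[OF L, of l] l by simp
  also have "\<dots> = \<eta>"
    unfolding l_def using \<eta> by (simp add: exp_minus)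
  finally show "2 * (real N)\<^sup>2 * exp (- (m * (\<epsilon> / (4 * (\<bar>B\<bar> + 1)))\<^sup>2 / 16)) \<le> \<eta>" .
qed

theorem theorem11:
  fixes \<eta> B :: real
  assumes "0 < \<eta>" and "\<eta> < 1"
  shows "\<exists>c>0. \<forall>(\<sigma>::real) (N::nat) (n::nat) (m::nat) (s::nat) (k::nat) (\<epsilon>::real) (\<alpha>::real)
           (x :: nat \<Rightarrow> real vec) (lam :: nat \<Rightarrow> real) (v :: nat \<Rightarrow> real vec).
      0 < \<sigma> \<longrightarrow>
      1 \<le> s \<longrightarrow> s \<le> n \<longrightarrow>
      (\<forall>i<N. x i \<in> carrier_vec n \<and> sparse_vec s (x i)) \<longrightarrow>
      1 \<le> k \<longrightarrow> k < N \<longrightarrow>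
      0 < \<epsilon> \<longrightarrow> \<epsilon> < 1 \<longrightarrow>
      max_scaled_sqdist \<sigma> N x = B \<longrightarrow>
      ordered_orthonormal_eigenbasis (affinity_mat \<sigma> N x) lam v \<longrightarrow>
      0 < \<alpha> \<longrightarrow>
      lam (k - 1) - lam k \<ge> \<alpha> \<longrightarrow> lam (k - 1) \<ge> \<alpha> \<longrightarrow>
      real m \<ge> c * (real s / \<epsilon>\<^sup>2) * ln (real n / (\<epsilon>\<^sup>2 * real s)) \<longrightarrow>
      (\<exists>E \<in> sets (gaussian_space m n).
         measure (gaussian_space m n) E \<ge> 1 - \<eta> \<and>
         (\<forall>\<omega>\<in>E. \<forall>lam' v' Q.
            ordered_orthonormal_eigenbasis
              (affinity_mat \<sigma> N (\<lambda>i. compressed m (gaussian_mat m n \<omega>) (x i))) lam' v' \<longrightarrow>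
            is_arg_min (\<lambda>R. frob_norm (first_cols N k v' - first_cols N k v * R))
              (\<lambda>R. R \<in> orthogonal_mats k) Q \<longrightarrow>
            (\<forall>i<N. vnorm (row (first_cols N k v') i - row (first_cols N k v * Q) i)
                     \<le> (1 + sqrt 2) * (real N * \<epsilon> / \<alpha>))))"
proof (intro exI[of _ "256 * (\<bar>B\<bar> + 1)\<^sup>2 * (1 + ln (2 / \<eta>))"] conjI allI impI, goal_cases)
  case 1
  show ?case
    using assms by (intro mult_pos_pos) (auto simp: add_nonneg_pos)
next
  case (2 \<sigma> N n m s k \<epsilon> \<alpha> x lam v)
  note \<sigma> = 2(1) and s = 2(2,3) and k = 2(5,6) and \<epsilon> = 2(7,8) and B = 2(9) and basis = 2(10)
    and gap = 2(11,12) and top = 2(13) and m = 2(14)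
  let ?Phi = "\<lambda>\<omega> i. compressed m (gaussian_mat m n \<omega>) (x i)"
  let ?A = "affinity_mat \<sigma> N x"
  have x: "x i \<in> carrier_vec n" if "i < N" for i
    using 2(4) that by blast
  note A = affinity_mat_carrier[of \<sigma> N x] basis
  have sqrt2: "1 \<le> sqrt 2"
    by simp
  show ?case
  \<comment> \<open>If \<open>N \<epsilon> \<ge> 1\<close>, the bound is at least \<open>1 + sqrt 2\<close> and holds on the whole space.\<close>
  proof (cases "real N * \<epsilon> < 1")
    case False
    have "\<alpha> \<le> 1"
      using top affinity_eigenvalue_le_one[OF x basis, of "k - 1"] k by linarith
    then have "1 \<le> real N * \<epsilon> / \<alpha>"
      using False gap(1) by simp
    then have "2 * 1 \<le> (1 + sqrt 2) * (real N * \<epsilon> / \<alpha>)"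
      using sqrt2 by (intro mult_mono) auto
    then have "vnorm (row (first_cols N k v') i - row (first_cols N k v * Q) i) \<le> (1 + sqrt 2) * (real N * \<epsilon> / \<alpha>)"
      if "ordered_orthonormal_eigenbasis (affinity_mat \<sigma> N (?Phi \<omega>)) lam' v'"
        and "is_arg_min (\<lambda>R. frob_norm (first_cols N k v' - first_cols N k v * R)) (\<lambda>R. R \<in> orthogonal_mats k) Q"
        and "i < N" for \<omega> lam' v' Q i
      using eigenvector_rows_distance_le_two[OF A affinity_mat_carrier that(1), of k i Q] that k
      by (auto simp: is_arg_min_def)
    moreover have "measure (gaussian_space m n) (space (gaussian_space m n)) \<ge> 1 - \<eta>"
      using assms prob_space.prob_space[OF prob_space_gaussian_space] by simp
    ultimately show ?thesis
      by (intro bexI[of _ "space (gaussian_space m n)"]) blast+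
  next
    case True
    have "2 * \<epsilon> \<le> real N * \<epsilon>"
      using k \<epsilon> by (intro mult_right_mono) auto
    then have \<epsilon>2: "\<epsilon> < 1 / 2"
      using True by linarith
    \<comment> \<open>A relative distortion \<open>\<delta>\<close> moves every scaled squared distance by at most \<open>\<epsilon> / 4\<close>.\<close>
    define \<delta> where "\<delta> = \<epsilon> / (4 * (\<bar>B\<bar> + 1))"
    have \<delta>: "0 < \<delta>" "\<delta> \<le> 1" "\<delta> * \<bar>B\<bar> \<le> \<epsilon> / 4"
    proof -
      show "0 < \<delta>" "\<delta> \<le> 1"
        using \<epsilon> by (auto simp: \<delta>_def divide_le_eq_1 add_nonneg_pos)
      have "\<delta> * \<bar>B\<bar> = \<epsilon> / 4 * (\<bar>B\<bar> / (\<bar>B\<bar> + 1))"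
        by (simp add: \<delta>_def)
      also have "\<dots> \<le> \<epsilon> / 4 * 1"
        using \<epsilon> by (intro mult_left_mono) (auto simp: divide_le_eq_1 add_nonneg_pos)
      finally show "\<delta> * \<bar>B\<bar> \<le> \<epsilon> / 4"
        by simp
    qed
    note prob = failure_probability_le[OF assms \<epsilon>(1) \<epsilon>2 True s m]
    obtain E where E: "E \<in> sets (gaussian_space m n)"
        "measure (gaussian_space m n) E \<ge> 1 - 2 * (real N)\<^sup>2 * exp (- (m * \<delta>\<^sup>2 / 16))"
        "\<And>\<omega> i j. \<omega> \<in> E \<Longrightarrow> i < N \<Longrightarrow> j < N \<Longrightarrow>
          \<bar>scaled_sqdist \<sigma> (?Phi \<omega> i) (?Phi \<omega> j) - scaled_sqdist \<sigma> (x i) (x j)\<bar>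
            \<le> \<delta> * scaled_sqdist \<sigma> (x i) (x j)"
      using compressed_distances_event[of N x n \<sigma> m \<delta>] x \<sigma> prob(1) \<delta> by blast
    have bound: "vnorm (row (first_cols N k v') i - row (first_cols N k v * Q) i) \<le> (1 + sqrt 2) * (real N * \<epsilon> / \<alpha>)"
      if \<omega>: "\<omega> \<in> E" and basis': "ordered_orthonormal_eigenbasis (affinity_mat \<sigma> N (?Phi \<omega>)) lam' v'"
        and Q: "is_arg_min (\<lambda>R. frob_norm (first_cols N k v' - first_cols N k v * R)) (\<lambda>R. R \<in> orthogonal_mats k) Q"
        and i: "i < N" for \<omega> lam' v' Q i
    proof -
      let ?A' = "affinity_mat \<sigma> N (?Phi \<omega>)" and ?D = "first_cols N k v' - first_cols N k v * Q"
      have close: "\<bar>scaled_sqdist \<sigma> (?Phi \<omega> i) (?Phi \<omega> j) - scaled_sqdist \<sigma> (x i) (x j)\<bar> \<le> \<epsilon> / 4"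
        if "i < N" "j < N" for i j
      proof -
        have "\<delta> * scaled_sqdist \<sigma> (x i) (x j) \<le> \<delta> * \<bar>B\<bar>"
          using scaled_sqdist_le_max[OF that, of \<sigma> x] B \<delta>(1) by (intro mult_left_mono) auto
        with E(3)[OF \<omega> that] \<delta>(3) show ?thesis
          by linarith
      qed
      have "frob_norm (?A - ?A') \<le> real N * (4 * (\<epsilon> / 4))"
        using \<epsilon> by (intro affinity_mat_perturbation[OF \<sigma> _ _ close]) auto
      then have "2 * frob_norm (?A - ?A') / \<alpha> \<le> 2 * (real N * \<epsilon> / \<alpha>)"
        using gap(1) by (simp add: divide_right_mono)
      moreover have "frob_norm ?D \<le> 2 * frob_norm (?A - ?A') / \<alpha>"
        by (rule aligned_eigenvectors_perturbation[OF A affinity_mat_carrier basis' k gap Q])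
      moreover have "2 * (real N * \<epsilon> / \<alpha>) \<le> (1 + sqrt 2) * (real N * \<epsilon> / \<alpha>)"
        using sqrt2 \<epsilon> gap by (intro mult_right_mono) auto
      moreover have "vnorm (row ?D i) \<le> frob_norm ?D"
        using i by (intro vnorm_row_le_frob_norm) simp
      moreover have "row ?D i = row (first_cols N k v') i - row (first_cols N k v * Q) i"
        using i Q by (intro eq_vecI) (auto simp: is_arg_min_def orthogonal_mats_def)
      ultimately show ?thesis
        by simp
    qed
    have "measure (gaussian_space m n) E \<ge> 1 - \<eta>"
      using E(2) prob(2) unfolding \<delta>_def by linarith
    with E(1) bound show ?thesis
      by blast
  qed
qed

end
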